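(* Let $\vec{m}=(m_1,\dots,m_n)$ be a sequence of integers with $m_i\ge 1$ for each $i\in\{1,\dots,n\}$, let $\vec{\lambda}=(\lambda_1,\dots,\lambda_n)$ be a sequence of non-negative integers, and let $|\vec{\lambda}|=\sum_{i=1}^n\lambda_i$. Then $$\mathrm{BD}^{\vec{\lambda}}(G_n(\vec{m}))\simeq\bigvee_{T\subseteq E(P_n)}\left(\bigvee_{\prod_{i=1}^n\binom{m_i-1}{\lambda_i-T_i}}\mathbb{S}^{|\vec{\lambda}|-\#T-1}\right).$$
   Context: The caterpillar graph $G_n(m_1,\dots,m_n)$ is the tree consisting of a central path $P_n$ with vertices $v_1,\dots,v_n$ and edges $e_i=\{v_i,v_{i+1}\}$, $1\le i\le n-1$, together with, for each $i$, $m_i$ additional leaf vertices each joined by a single edge to $v_i$. $\mathrm{BD}^{\vec{\lambda}}(G_n(\vec{m}))$ denotes the simplicial complex whose vertices are the edges of $G_n(\vec{m})$ and whose faces are the sets $H$ of edges such that, in the subgraph with edge set $H$, each central vertex $v_i$ has degree at most $\lambda_i$ and each leaf vertex has degree at most $1$. For $T\subseteq E(P_n)$, $\#T$ is the number of edges in $T$ and $T_i\in\{0,1,2\}$ is the degree of $v_i$ in the subgraph of $P_n$ with edge set $T$. Binomial coefficients $\binom{a}{b}$ are $0$ when $b<0$ or $b>a$; a wedge of zero spheres denotes a contractible space (a point); $\mathbb{S}^{-1}$ denotes the complex $\{\emptyset\}$. *)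

theory Defs
  imports "HOL-Analysis.Analysis"
begin

text \<open>Graphs are given by a vertex set and a set of edges, each edge being the set of its two ends.\<close>

definition vdegree :: "'v set set \<Rightarrow> 'v \<Rightarrow> nat" where
  "vdegree H v = card {e \<in> H. v \<in> e}"

definition bounded_degree_complex :: "'v set \<Rightarrow> 'v set set \<Rightarrow> ('v \<Rightarrow> nat) \<Rightarrow> 'v set set set" where
  "bounded_degree_complex V E b = {H. H \<subseteq> E \<and> (\<forall>v\<in>V. vdegree H v \<le> b v)}"

text \<open>\<open>Leaf i j\<close> is the \<open>j\<close>-th leaf attached to the central vertex \<open>Central i\<close>.\<close>

datatype cvertex = Central nat | Leaf nat nat

definition path_edges :: "nat \<Rightarrow> cvertex set set" where
  "path_edges n = {{Central i, Central (i + 1)} | i. 1 \<le> i \<and> i < n}"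

definition caterpillar_vertices :: "nat \<Rightarrow> (nat \<Rightarrow> nat) \<Rightarrow> cvertex set" where
  "caterpillar_vertices n m =
     Central ` {1..n} \<union> {Leaf i j | i j. i \<in> {1..n} \<and> j \<in> {1..m i}}"

definition caterpillar_edges :: "nat \<Rightarrow> (nat \<Rightarrow> nat) \<Rightarrow> cvertex set set" where
  "caterpillar_edges n m =
     path_edges n \<union> {{Central i, Leaf i j} | i j. i \<in> {1..n} \<and> j \<in> {1..m i}}"

fun caterpillar_bound :: "(nat \<Rightarrow> nat) \<Rightarrow> cvertex \<Rightarrow> nat" where
  "caterpillar_bound l (Central i) = l i"
| "caterpillar_bound l (Leaf i j) = 1"

definition BD_caterpillar :: "nat \<Rightarrow> (nat \<Rightarrow> nat) \<Rightarrow> (nat \<Rightarrow> nat) \<Rightarrow> cvertex set set set" where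
  "BD_caterpillar n m l =
     bounded_degree_complex (caterpillar_vertices n m) (caterpillar_edges n m) (caterpillar_bound l)"

text \<open>
  Geometric realization of a finite abstract simplicial complex (a downward closed family of
  finite sets containing the empty set), in barycentric coordinates. For finite complexes the
  topology of pointwise convergence used here is the usual one. The complex whose only face is
  the empty set is realized by the empty space.
\<close>

definition geometric_realization :: "'a set set \<Rightarrow> ('a \<Rightarrow> real) topology" where
  "geometric_realization K = subtopology (powertop_real UNIV)
     {x. (\<forall>a. 0 \<le> x a) \<and> {a. x a \<noteq> 0} \<in> K \<and> (\<Sum>a | x a \<noteq> 0. x a) = 1}"

definition quotient_topology :: "'a topology \<Rightarrow> ('a \<Rightarrow> 'b) \<Rightarrow> 'b topology" where
  "quotient_topology X q =
     topology (\<lambda>U. U \<subseteq> q ` topspace X \<and> openin X {x \<in> topspace X. q x \<in> U})"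

lemma istopology_quotient:
  "istopology (\<lambda>U. U \<subseteq> q ` topspace X \<and> openin X {x \<in> topspace X. q x \<in> U})"
proof -
  have 1: "{x \<in> topspace X. q x \<in> S \<inter> T} =
      {x \<in> topspace X. q x \<in> S} \<inter> {x \<in> topspace X. q x \<in> T}" for S T
    by blast
  have 2: "{x \<in> topspace X. q x \<in> \<Union>\<U>} = (\<Union>U\<in>\<U>. {x \<in> topspace X. q x \<in> U})" for \<U>
    by blast
  show ?thesis
    unfolding istopology_def 1 2 by blast
qed

lemma openin_quotient_topology:
  "openin (quotient_topology X q) U \<longleftrightarrow>
     U \<subseteq> q ` topspace X \<and> openin X {x \<in> topspace X. q x \<in> U}"
  unfolding quotient_topology_def by (simp add: topology_inverse'[OF istopology_quotient])

lemma topspace_quotient_topology: "topspace (quotient_topology X q) = q ` topspace X"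
proof
  show "topspace (quotient_topology X q) \<subseteq> q ` topspace X"
    using openin_quotient_topology openin_topspace by metis
  have "{x \<in> topspace X. q x \<in> q ` topspace X} = topspace X"
    by blast
  then have "openin (quotient_topology X q) (q ` topspace X)"
    by (simp add: openin_quotient_topology)
  then show "q ` topspace X \<subseteq> topspace (quotient_topology X q)"
    by (rule openin_subset)
qed

lemma quotient_map_quotient_topology: "quotient_map X (quotient_topology X q) q"
  unfolding quotient_map_def
  by (simp add: openin_quotient_topology topspace_quotient_topology)

text \<open>
  Wedge of the spaces \<open>X i\<close> at the base points \<open>p i\<close>: the disjoint union with all base points
  identified to the single point \<open>None\<close>. The wedge of no spaces is a point. An empty space
  contributes no point, so the wedge of a single copy of the empty space is empty.
\<close>

definition wedge_sum ::
    "'i set \<Rightarrow> ('i \<Rightarrow> 'b topology) \<Rightarrow> ('i \<Rightarrow> 'b) \<Rightarrow> ('i \<times> 'b) option topology" where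
  "wedge_sum I X p =
     (if I = {} then discrete_topology {None}
      else quotient_topology (sum_topology X I) (\<lambda>(i, y). if y = p i then None else Some (i, y)))"

text \<open>
  The sphere of dimension \<open>d\<close>; it is empty for \<open>d = -1\<close>. Smaller values of \<open>d\<close> are immaterial.
\<close>

definition sphere_space :: "int \<Rightarrow> (nat \<Rightarrow> real) topology" where
  "sphere_space d = (if d < 0 then trivial_topology else nsphere (nat d))"

definition sphere_basepoint :: "nat \<Rightarrow> real" where
  "sphere_basepoint = (\<lambda>i. if i = 0 then 1 else 0)"

definition wedge_of_spheres :: "'i set \<Rightarrow> ('i \<Rightarrow> int) \<Rightarrow> ('i \<times> (nat \<Rightarrow> real)) option topology" where
  "wedge_of_spheres I d = wedge_sum I (\<lambda>i. sphere_space (d i)) (\<lambda>_. sphere_basepoint)"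

definition int_binom :: "int \<Rightarrow> int \<Rightarrow> nat" where
  "int_binom a b = (if b < 0 \<or> b > a then 0 else nat a choose nat b)"

text \<open>
  The iterated wedge over \<open>T\<close> and then over \<open>sphere_count n m l T\<close> copies is a single wedge
  indexed by pairs. A \<open>T\<close> with count zero thus contributes nothing; an extra one-point summand
  would be wrong next to the empty sphere, which occurs when all \<open>l i\<close> vanish.
\<close>

definition sphere_count :: "nat \<Rightarrow> (nat \<Rightarrow> nat) \<Rightarrow> (nat \<Rightarrow> nat) \<Rightarrow> cvertex set set \<Rightarrow> nat" where
  "sphere_count n m l T =
     (\<Prod>i = 1..n. int_binom (int (m i) - 1) (int (l i) - int (vdegree T (Central i))))"

end

theory Submission
  imports Defs
begin

text \<open>
  Let \<open>a i\<close> be the edge joining \<open>Central i\<close> to its first leaf. Call a face critical if it contains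
  no \<open>a i\<close> and attains the degree bound at every central vertex. Critical faces are facets, and the
  remaining faces are exactly those that lie in the star of some \<open>a i\<close>. Since distinct \<open>a i\<close> meet
  distinct degree constraints, every intersection of such stars is the star of a simplex, hence a
  cone, so the noncritical subcomplex is contractible. An
  explicit contraction, defined on the whole complex, shows that collapsing this subcomplex is a
  homotopy equivalence. The quotient has one sphere for each critical facet. A critical facet whose
  set of path edges is \<open>T\<close> consists of \<open>|\<lambda>| - #T\<close> edges, and it amounts to a choice of
  \<open>\<lambda> i - T i\<close> of the \<open>m i - 1\<close> other leaves at every central vertex.
\<close>

section \<open>Collapsing a contractible subspace\<close>

text \<open>Contractibility of the noncritical subcomplex by itself would call for a homotopy
  extension argument. The homotopy used here runs on the whole realization, starts at the identity,
  maps the subcomplex into itself and ends constant on it; its end map therefore factors through the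
  quotient and yields the homotopy inverse directly. The stars of the \<open>a i\<close> enter
  through weights, in the manner of a partition of unity. All \<open>a i\<close> with
  \<open>l i > 0\<close> span one common noncritical face, so points that carry enough weight slide
  into that simplex and from there to one vertex. In the middle of a critical facet all weights
  vanish, so the motion has to die out there continuously; this is why thresholds and cut-off
  functions appear. When every bound is 0 the subcomplex has no points to collapse to and the
  complex is the empty sphere, a case treated apart.\<close>

lemma homotopy_equivalent_space_collapse:
  assumes comp: "compact_space X" and haus: "Hausdorff_space Y"
    and q: "continuous_map X Y q" "q ` topspace X = topspace Y"
    and hom: "homotopic_with (\<lambda>g. g ` A \<subseteq> A) X X id f"
    and f: "\<And>x. x \<in> A \<Longrightarrow> f x = a"
    and fibre: "\<And>x y. \<lbrakk>x \<in> topspace X; y \<in> topspace X; q x = q y\<rbrakk> \<Longrightarrow> x = y \<or> x \<in> A \<and> y \<in> A"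
    and const: "\<And>x y. \<lbrakk>x \<in> A; y \<in> A\<rbrakk> \<Longrightarrow> q x = q y"
  shows "X homotopy_equivalent_space Y"
proof -
  let ?I = "top_of_set {0..1::real}"
  obtain h where h: "continuous_map (prod_topology ?I X) X h"
    and h0: "\<And>x. h (0, x) = x" and h1: "\<And>x. h (1, x) = f x"
    and hA: "\<And>t. t \<in> {0..1} \<Longrightarrow> (\<lambda>x. h (t, x)) ` A \<subseteq> A"
    using hom unfolding homotopic_with_def by auto
  have contf: "continuous_map X X f"
    using homotopic_with_imp_continuous_maps[OF hom] by simp
  have qX: "quotient_map X Y q"
    using continuous_imp_quotient_map[OF q(1) comp haus q(2)] .
  \<comment> \<open>The homotopy inverse of \<open>q\<close>: a fibre with more than one point lies
    in \<open>A\<close>, where \<open>f\<close> has the single value \<open>a\<close>, so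
    \<open>f\<close> factors through \<open>q\<close>.\<close>
  obtain p where p: "continuous_map Y X p" "\<And>x. x \<in> topspace X \<Longrightarrow> p (q x) = f x"
    using quotient_map_lift_exists[OF qX contf] fibre f by metis
  \<comment> \<open>To descend \<open>h\<close> to a homotopy on \<open>Y\<close>, the map
    \<open>q\<close> times the interval must again be a quotient map; compactness of the source and
    the Hausdorff property of the target give this.\<close>
  let ?q = "\<lambda>(t::real, x). (t, q x)"
  have quot: "quotient_map (prod_topology ?I X) (prod_topology ?I Y) ?q"
  proof (rule T1_Spaces.continuous_imp_quotient_map)
    have "continuous_map (prod_topology ?I X) (prod_topology ?I Y) (\<lambda>z. (fst z, (q \<circ> snd) z))"
      by (intro continuous_map_pairedI continuous_map_fst continuous_map_compose[OF continuous_map_snd q(1)])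
    then show "continuous_map (prod_topology ?I X) (prod_topology ?I Y) ?q"
      by (simp add: case_prod_unfold)
    show "compact_space (prod_topology ?I X)"
      using comp by (simp add: compact_space_prod_topology compact_space_subtopology)
    show "Hausdorff_space (prod_topology ?I Y)"
      using haus by (simp add: Hausdorff_space_prod_topology Hausdorff_space_subtopology)
    show "?q ` topspace (prod_topology ?I X) = topspace (prod_topology ?I Y)"
      using q(2) by (force simp: image_iff)
  qed
  have qh: "continuous_map (prod_topology ?I X) Y (q \<circ> h)"
    using h q(1) by (rule continuous_map_compose)
  \<comment> \<open>Invariance of \<open>A\<close> at every time \<open>t\<close> matters here:
    identified points of \<open>A\<close> may separate under \<open>h\<close>, but they stay in
    \<open>A\<close> and so remain identified.\<close>
  have fibre_qh: "(q \<circ> h) z = (q \<circ> h) z'"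
    if z: "z \<in> topspace (prod_topology ?I X)" "z' \<in> topspace (prod_topology ?I X)" "?q z = ?q z'" for z z'
  proof -
    obtain t x y where zz: "z = (t, x)" "z' = (t, y)" "t \<in> {0..1}" "x \<in> topspace X" "y \<in> topspace X" "q x = q y"
      using z by (cases z; cases z') auto
    show ?thesis
      using fibre[OF zz(4-6)] const[of "h (t, x)" "h (t, y)"] hA[OF zz(3)] zz(1,2) by auto
  qed
  obtain k where k: "continuous_map (prod_topology ?I Y) Y k"
    "\<And>z. z \<in> topspace (prod_topology ?I X) \<Longrightarrow> k (?q z) = (q \<circ> h) z"
    by (rule quotient_map_lift_exists[OF quot qh fibre_qh]) (assumption | rule that)+
  have pq: "homotopic_with (\<lambda>_. True) X X id (p \<circ> q)"
  proof (rule homotopic_with_eq)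
    show "homotopic_with (\<lambda>_. True) X X id f"
      using hom by (rule homotopic_with_mono) simp
  qed (auto simp: p)
  have qp: "homotopic_with (\<lambda>_. True) Y Y id (q \<circ> p)"
  proof -
    have "k (0, y) = y \<and> k (1, y) = q (p y)" if y: "y \<in> topspace Y" for y
    proof -
      obtain x where x: "x \<in> topspace X" "y = q x" using y q(2) by (metis imageE)
      show ?thesis using k(2)[of "(0, x)"] k(2)[of "(1, x)"] x by (simp add: h0 h1 p)
    qed
    then show ?thesis
      using k(1) by (subst homotopic_with) auto
  qed
  show ?thesis
    unfolding homotopy_equivalent_space_def
    using q(1) p(1) homotopic_with_symD[OF pq] homotopic_with_symD[OF qp] by blast
qed

section \<open>Simplices modulo their boundary\<close>

text \<open>
  Inverse stereographic projection of the vector \<open>(v j - v 0) / P\<close>, \<open>1 \<le> j \<le> d\<close>, where \<open>P\<close> is the least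
  barycentric coordinate: the point at infinity is the base point and corresponds to \<open>P = 0\<close>, the
  boundary. The term \<open>R\<close> vanishes on the simplex itself; it keeps the denominator positive on the
  rest of the complex.
\<close>

definition simplex_to_sphere :: "nat \<Rightarrow> (nat \<Rightarrow> real) \<Rightarrow> nat \<Rightarrow> real" where
  "simplex_to_sphere d v =
     (let P = Min (v ` {..d}); R = (1 - (\<Sum>j\<le>d. v j))\<^sup>2; Z = (\<Sum>j=1..d. (v j - v 0)\<^sup>2); D = Z + R + P\<^sup>2
      in (\<lambda>j. if j = 0 then (Z + R - P\<^sup>2) / D else if j \<le> d then 2 * P * (v j - v 0) / D else 0))"

text \<open>If all three squares vanish, the coordinates are equal and their minimum is 0, so all
  are 0, which contradicts their sum being 1.\<close>

lemma simplex_to_sphere_denominator: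
  fixes v :: "nat \<Rightarrow> real"
  shows "0 < (\<Sum>j=1..d. (v j - v 0)\<^sup>2) + (1 - (\<Sum>j\<le>d. v j))\<^sup>2 + (Min (v ` {..d}))\<^sup>2" (is "0 < ?Z + ?R + ?P")
proof (rule ccontr)
  assume "\<not> ?thesis"
  moreover have "0 \<le> ?Z" "0 \<le> ?R" "0 \<le> ?P" by (auto intro: sum_nonneg)
  ultimately have 0: "?Z = 0" "?R = 0" "?P = 0" by linarith+
  have eq: "v j = v 0" if "j \<le> d" for j
    using 0(1) that by (cases "j = 0") (auto simp: sum_nonneg_eq_0_iff)
  have "v ` {..d} = (\<lambda>_. v 0) ` {..d}" by (rule image_cong) (auto intro: eq)
  then have "v 0 = 0" using 0(3) by (simp add: image_constant_conv)
  then have "v j = 0" if "j \<le> d" for j using eq[OF that] by simp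
  then have "(\<Sum>j\<le>d. v j) = 0" by simp
  then show False using 0(2) by simp
qed

lemma continuous_on_Min_image:
  fixes f :: "'i \<Rightarrow> 'a::topological_space \<Rightarrow> real"
  assumes "finite J" "J \<noteq> {}" "\<And>j. j \<in> J \<Longrightarrow> continuous_on S (f j)"
  shows "continuous_on S (\<lambda>x. Min ((\<lambda>j. f j x) ` J))"
  using assms
proof (induction J rule: finite_ne_induct)
  case (insert j J)
  then have "continuous_on S (\<lambda>x. min (f j x) (Min ((\<lambda>j. f j x) ` J)))"
    by (intro continuous_on_min) auto
  then show ?case using insert by simp
qed simp

lemma continuous_on_simplex_to_sphere: "continuous_on UNIV (simplex_to_sphere d)"
proof (rule continuous_on_coordinatewise_then_product)
  fix j
  have P: "continuous_on UNIV (\<lambda>v::nat \<Rightarrow> real. Min (v ` {..d}))"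
    using continuous_on_Min_image[of "{..d}" UNIV "\<lambda>j v. v j"] by simp
  have D: "(\<Sum>j=1..d. (v j - v 0)\<^sup>2) + (1 - (\<Sum>j\<le>d. v j))\<^sup>2 + (Min (v ` {..d}))\<^sup>2 \<noteq> 0" for v :: "nat \<Rightarrow> real"
    using simplex_to_sphere_denominator[of v d] by linarith
  show "continuous_on UNIV (\<lambda>v. simplex_to_sphere d v j)"
    unfolding simplex_to_sphere_def Let_def
    by (cases "j = 0"; cases "j \<le> d"; simp only: if_True if_False refl)
       (intro continuous_intros P continuous_on_product_coordinates ballI D; simp)+
qed

lemma topspace_nsphere: "topspace (nsphere d) = {x. (\<Sum>i\<le>d. x i ^ 2) = 1 \<and> (\<forall>i>d. x i = 0)}"
  by (simp add: nsphere)

lemma sum_atMost_split_0: "(\<Sum>j\<le>d. f j) = f 0 + (\<Sum>j=1..d. f j)" for f :: "nat \<Rightarrow> real"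
  by (simp add: sum.atLeast_Suc_atMost atMost_atLeast0)

text \<open>With \<open>r\<close> the defect of the coordinate sum from 1, the squared norm is 1
  minus a multiple of \<open>(P * r)\<^sup>2\<close>. The hypothesis covers both situations that
  occur on a complex: the sum over the facet is 1, or some coordinate of the facet is 0.\<close>

lemma simplex_to_sphere_in_nsphere:
  assumes "Min (v ` {..d}) * (1 - (\<Sum>j\<le>d. v j)) = 0"
  shows "simplex_to_sphere d v \<in> topspace (nsphere d)"
proof -
  define P where "P = Min (v ` {..d})"
  define r where "r = 1 - (\<Sum>j\<le>d. v j)"
  define Z where "Z = (\<Sum>j=1..d. (v j - v 0)\<^sup>2)"
  define D where "D = Z + r\<^sup>2 + P\<^sup>2"
  have D: "D > 0" using simplex_to_sphere_denominator[of v d] by (simp add: D_def P_def r_def Z_def)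
  have Pr: "P * r = 0" using assms by (simp add: P_def r_def)
  have s: "simplex_to_sphere d v j = (if j = 0 then (Z + r\<^sup>2 - P\<^sup>2) / D else if j \<le> d then 2 * P * (v j - v 0) / D else 0)" for j
    by (simp add: simplex_to_sphere_def Let_def P_def r_def Z_def D_def)
  have "(\<Sum>j\<le>d. (simplex_to_sphere d v j)\<^sup>2) = ((Z + r\<^sup>2 - P\<^sup>2) / D)\<^sup>2 + (\<Sum>j=1..d. (2 * P * (v j - v 0) / D)\<^sup>2)"
    by (simp add: sum_atMost_split_0 s cong: sum.cong_simp)
  also have "(\<Sum>j=1..d. (2 * P * (v j - v 0) / D)\<^sup>2) = (2 * P / D)\<^sup>2 * Z"
    by (simp add: Z_def sum_distrib_left power_mult_distrib power_divide)
  also have "((Z + r\<^sup>2 - P\<^sup>2) / D)\<^sup>2 + (2 * P / D)\<^sup>2 * Z = ((Z + r\<^sup>2 - P\<^sup>2)\<^sup>2 + 4 * P\<^sup>2 * Z) / D\<^sup>2"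
    by (simp add: power_divide power_mult_distrib add_divide_distrib)
  also have "(Z + r\<^sup>2 - P\<^sup>2)\<^sup>2 + 4 * P\<^sup>2 * Z = D\<^sup>2 - 4 * (P * r)\<^sup>2"
    unfolding D_def by (simp add: power2_eq_square algebra_simps)
  also have "\<dots> / D\<^sup>2 = 1" using D Pr by simp
  finally show ?thesis by (simp add: topspace_nsphere s)
qed

lemma simplex_to_sphere_boundary:
  assumes "Min (v ` {..d}) = 0"
  shows "simplex_to_sphere d v = sphere_basepoint"
proof -
  have "(\<Sum>j=1..d. (v j - v 0)\<^sup>2) + (1 - (\<Sum>j\<le>d. v j))\<^sup>2 \<noteq> 0"
    using simplex_to_sphere_denominator[of v d] assms by simp
  then show ?thesis
    using assms by (simp add: fun_eq_iff simplex_to_sphere_def Let_def sphere_basepoint_def)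
qed

text \<open>The second quotient is stereographic projection from the base point, which recovers the
  vector that was projected to the sphere.\<close>

lemma simplex_to_sphere_interior:
  assumes "Min (v ` {..d}) > 0"
  shows "simplex_to_sphere d v 0 < 1"
    and "\<lbrakk>0 < j; j \<le> d\<rbrakk> \<Longrightarrow> simplex_to_sphere d v j / (1 - simplex_to_sphere d v 0) = (v j - v 0) / Min (v ` {..d})"
proof -
  define P where "P = Min (v ` {..d})"
  define Q where "Q = (\<Sum>j=1..d. (v j - v 0)\<^sup>2) + (1 - (\<Sum>j\<le>d. v j))\<^sup>2"
  have P: "P > 0" using assms by (simp add: P_def)
  have D: "Q + P\<^sup>2 > 0" using simplex_to_sphere_denominator[of v d] by (simp add: P_def Q_def)
  have s0: "simplex_to_sphere d v 0 = (Q - P\<^sup>2) / (Q + P\<^sup>2)"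
    by (simp add: simplex_to_sphere_def Let_def P_def Q_def)
  have s1: "1 - simplex_to_sphere d v 0 = 2 * P\<^sup>2 / (Q + P\<^sup>2)"
    using D by (simp add: s0 field_simps)
  have "2 * P\<^sup>2 / (Q + P\<^sup>2) > 0" using P D by simp
  then show "simplex_to_sphere d v 0 < 1" using s1 by linarith
  assume "0 < j" "j \<le> d"
  then have "simplex_to_sphere d v j = 2 * P * (v j - v 0) / (Q + P\<^sup>2)"
    by (simp add: simplex_to_sphere_def Let_def P_def Q_def)
  then have "simplex_to_sphere d v j / (1 - simplex_to_sphere d v 0)
      = (2 * P * (v j - v 0) / (Q + P\<^sup>2)) / (2 * P\<^sup>2 / (Q + P\<^sup>2))"
    by (simp add: s1)
  also have "\<dots> = (v j - v 0) / P"
    using P D by (simp add: power2_eq_square)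
  finally show "simplex_to_sphere d v j / (1 - simplex_to_sphere d v 0) = (v j - v 0) / Min (v ` {..d})"
    by (simp add: P_def)
qed

text \<open>Equal projections make \<open>v / P\<close> and \<open>w / Q\<close> differ by a
  constant. Both have least entry 1, so the constant is 0, and the equal sums then force
  \<open>P = Q\<close>.\<close>

lemma simplex_to_sphere_inj:
  assumes v: "Min (v ` {..d}) > 0" "(\<Sum>j\<le>d. v j) = 1"
    and w: "Min (w ` {..d}) > 0" "(\<Sum>j\<le>d. w j) = 1"
    and eq: "simplex_to_sphere d v = simplex_to_sphere d w" and j: "j \<le> d"
  shows "v j = w j"
proof -
  define P where "P = Min (v ` {..d})"
  define Q where "Q = Min (w ` {..d})"
  have P: "P > 0" and Q: "Q > 0" using v w by (auto simp: P_def Q_def)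
  have dif: "(v j - v 0) / P = (w j - w 0) / Q" if "j \<le> d" for j
    using simplex_to_sphere_interior(2)[OF v(1), of j] simplex_to_sphere_interior(2)[OF w(1), of j] that
    by (cases "j = 0") (auto simp: eq P_def Q_def)
  define c where "c = v 0 / P - w 0 / Q"
  have c: "v j / P = w j / Q + c" if "j \<le> d" for j
    using dif[OF that] by (simp add: c_def diff_divide_distrib)
  have "P \<in> v ` {..d}" "Q \<in> w ` {..d}"
    by (auto simp: P_def Q_def intro!: Min_in)
  then obtain i k where ik: "i \<le> d" "P = v i" "k \<le> d" "Q = w k" by auto
  have "v k \<ge> P" "w i \<ge> Q" unfolding P_def Q_def using ik by auto
  then have "v k / P \<ge> 1" "w i / Q \<ge> 1" "v i / P = 1" "w k / Q = 1" using P Q ik by auto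
  then have c0: "c = 0" using c[of i] c[of k] ik by simp
  have vw: "v j * Q = w j * P" if "j \<le> d" for j
    using c[OF that] P Q by (simp add: c0 field_simps)
  have "(\<Sum>j\<le>d. v j) * Q = (\<Sum>j\<le>d. w j) * P"
    unfolding sum_distrib_right using vw by (intro sum.cong) auto
  then have "Q = P" using v w by simp
  then show ?thesis using vw[OF j] P by simp
qed

lemma simplex_to_sphere_surj:
  assumes s: "s \<in> topspace (nsphere d)" "s \<noteq> sphere_basepoint"
  obtains v where "Min (v ` {..d}) > 0" "(\<Sum>j\<le>d. v j) = 1" "simplex_to_sphere d v = s"
proof -
  have sum: "(\<Sum>j\<le>d. (s j)\<^sup>2) = 1" and out: "\<And>j. j > d \<Longrightarrow> s j = 0"
    using s by (auto simp: topspace_nsphere)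
  have sum1: "(\<Sum>j=1..d. (s j)\<^sup>2) = 1 - (s 0)\<^sup>2" using sum by (simp add: sum_atMost_split_0)
  have s0: "s 0 \<noteq> 1"
  proof
    assume s01: "s 0 = 1"
    then have "\<forall>j\<in>{1..d}. (s j)\<^sup>2 = 0" using sum1 by (subst sum_nonneg_eq_0_iff[symmetric]) auto
    then have "s j = sphere_basepoint j" for j
      using s01 out[of j] by (cases "j = 0"; cases "j > d") (auto simp: sphere_basepoint_def)
    then show False using s(2) by auto
  qed
  \<comment> \<open>The inverse: project \<open>s\<close> stereographically, put 0 in front, shift
    until the least entry is 1, and divide by the sum \<open>S\<close>. The least barycentric
    coordinate becomes \<open>1 / S\<close>.\<close>
  define y where "y j = (if j = 0 then 0 else s j / (1 - s 0))" for j
  define \<mu> where "\<mu> = Min (y ` {..d})"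
  define S where "S = (\<Sum>j\<le>d. y j - \<mu> + 1)"
  define v where "v j = (y j - \<mu> + 1) / S" for j
  have \<mu>: "\<mu> \<le> y j" if "j \<le> d" for j using that by (simp add: \<mu>_def)
  have S: "S > 0" unfolding S_def
    by (rule sum_pos) (use \<mu> in \<open>auto simp: add_nonneg_pos\<close>)
  have Minv: "Min (v ` {..d}) = 1 / S"
  proof (rule Min_eqI)
    show "1 / S \<le> x" if "x \<in> v ` {..d}" for x
      using that \<mu> S by (auto simp: v_def divide_right_mono)
    have "\<mu> \<in> y ` {..d}" unfolding \<mu>_def by (rule Min_in) auto
    then show "1 / S \<in> v ` {..d}" by (auto simp: v_def)
  qed simp
  have sumv: "(\<Sum>j\<le>d. v j) = 1"
    using S by (simp add: v_def S_def flip: sum_divide_distrib)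
  have dv: "v j - v 0 = y j / S" for j
    by (simp add: v_def y_def flip: diff_divide_distrib)
  define Y where "Y = (\<Sum>j=1..d. (y j)\<^sup>2)"
  have "Y = (1 - (s 0)\<^sup>2) / (1 - s 0)\<^sup>2"
    unfolding sum1[symmetric] Y_def sum_divide_distrib by (intro sum.cong) (auto simp: y_def power_divide)
  also have "\<dots> = ((1 - s 0) * (1 + s 0)) / ((1 - s 0) * (1 - s 0))"
    by (simp add: power2_eq_square algebra_simps)
  also have "\<dots> = (1 + s 0) / (1 - s 0)" using s0 by simp
  finally have Y: "Y = (1 + s 0) / (1 - s 0)" .
  have Z: "(\<Sum>j=1..d. (v j - v 0)\<^sup>2) = Y / S\<^sup>2"
    by (simp add: dv Y_def power_divide sum_divide_distrib)
  have Y1: "Y + 1 = 2 / (1 - s 0)" "Y - 1 = 2 * s 0 / (1 - s 0)"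
    using s0 by (auto simp: Y field_simps)
  \<comment> \<open>The term \<open>(1 - 1)\<^sup>2\<close> is what \<open>R\<close> turns into once
    \<open>sumv\<close> is rewritten; it is kept so that these equations match the unfolded
    definition.\<close>
  have D: "Y / S\<^sup>2 + (1 - 1)\<^sup>2 + (1 / S)\<^sup>2 = (Y + 1) / S\<^sup>2"
    and N: "Y / S\<^sup>2 + (1 - 1)\<^sup>2 - (1 / S)\<^sup>2 = (Y - 1) / S\<^sup>2"
    by (simp_all add: power_divide add_divide_distrib diff_divide_distrib)
  have "simplex_to_sphere d v j = s j" for j
  proof -
    consider "j = 0" | "0 < j" "j \<le> d" | "j > d" by linarith
    then show ?thesis
    proof cases
      case 1
      have "simplex_to_sphere d v 0 = ((Y - 1) / S\<^sup>2) / ((Y + 1) / S\<^sup>2)"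
        unfolding simplex_to_sphere_def Let_def Minv sumv Z D N by simp
      also have "\<dots> = (Y - 1) / (Y + 1)" using S by simp
      also have "\<dots> = s 0" using s0 by (simp add: Y1)
      finally show ?thesis using 1 by simp
    next
      case 2
      then have "simplex_to_sphere d v j = (2 * (1 / S) * (y j / S)) / ((Y + 1) / S\<^sup>2)"
        unfolding simplex_to_sphere_def Let_def Minv sumv Z D by (simp add: dv)
      also have "\<dots> = 2 * y j / (Y + 1)" using S by (simp add: power2_eq_square)
      also have "\<dots> = s j" using s0 2 by (simp add: Y1 y_def)
      finally show ?thesis .
    qed (simp add: simplex_to_sphere_def Let_def out)
  qed
  then show ?thesis using that[of v] Minv sumv S by auto
qed

section \<open>Wedges\<close>

lemma continuous_map_from_sum_topology:
  assumes "\<And>i. i \<in> I \<Longrightarrow> continuous_map (X i) Y (\<lambda>x. f (i, x))"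
  shows "continuous_map (sum_topology X I) Y f"
proof -
  have "openin (X i) {x. (i, x) \<in> {z \<in> topspace (sum_topology X I). f z \<in> U}}"
    if "i \<in> I" "openin Y U" for i U
    using openin_continuous_map_preimage[OF assms[OF that(1)] that(2)] that(1) by simp
  then show ?thesis
    using assms unfolding continuous_map_def openin_sum_topology by fastforce
qed

lemma quotient_map_wedge_sum:
  assumes "I \<noteq> {}"
  shows "quotient_map (sum_topology X I) (wedge_sum I X p) (\<lambda>(i, y). if y = p i then None else Some (i, y))"
  using assms unfolding wedge_sum_def by (simp add: quotient_map_quotient_topology)

lemma continuous_map_wedge_inclusion:
  assumes "i \<in> I"
  shows "continuous_map (X i) (wedge_sum I X p) (\<lambda>y. if y = p i then None else Some (i, y))"
proof -
  have "I \<noteq> {}" using assms by auto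
  from continuous_map_compose[OF continuous_map_component_injection[OF assms, of X]
      quotient_imp_continuous_map[OF quotient_map_wedge_sum[OF this, of X p]]]
  show ?thesis by (simp add: o_def)
qed

lemma topspace_wedge_sum:
  assumes "\<And>i. i \<in> I \<Longrightarrow> p i \<in> topspace (X i)"
  shows "topspace (wedge_sum I X p) = insert None (Some ` (SIGMA i:I. topspace (X i) - {p i}))"
proof (cases "I = {}")
  case False
  have "(\<lambda>(i, y). if y = p i then None else Some (i, y)) ` (SIGMA i:I. topspace (X i))
      = insert None (Some ` (SIGMA i:I. topspace (X i) - {p i}))" (is "?f ` ?S = ?R")
  proof
    show "?f ` ?S \<subseteq> ?R" by (force split: if_splits)
    show "?R \<subseteq> ?f ` ?S"
    proof
      fix z assume "z \<in> ?R"
      then consider "z = None" | i y where "z = Some (i, y)" "i \<in> I" "y \<in> topspace (X i)" "y \<noteq> p i" by auto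
      then show "z \<in> ?f ` ?S"
      proof cases
        case 1
        obtain i where i: "i \<in> I" using False by auto
        then have "(i, p i) \<in> ?S" using assms by auto
        then show ?thesis using 1 by (force intro!: rev_image_eqI)
      next
        case 2
        then show ?thesis by (intro image_eqI[of _ _ "(i, y)"]) auto
      qed
    qed
  qed
  then show ?thesis
    using quotient_imp_surjective_map[OF quotient_map_wedge_sum[OF False, of X p]] by (simp add: o_def)
qed (simp add: wedge_sum_def)

text \<open>The wedge retracts onto each summand by sending all the others to the base point.
  Together these retractions form a continuous injection into the Hausdorff product of the
  summands.\<close>

lemma Hausdorff_space_wedge_sum:
  assumes X: "\<And>i. i \<in> I \<Longrightarrow> Hausdorff_space (X i)" and p: "\<And>i. i \<in> I \<Longrightarrow> p i \<in> topspace (X i)"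
  shows "Hausdorff_space (wedge_sum I X p)"
proof (cases "I = {}")
  case True
  then show ?thesis by (simp add: wedge_sum_def)
next
  case False
  define r where "r i z = (case z of None \<Rightarrow> p i | Some (j, y) \<Rightarrow> if j = i then y else p i)" for i z
  have cont: "continuous_map (wedge_sum I X p) (X i) (r i)" if i: "i \<in> I" for i
  proof (rule continuous_compose_quotient_map[OF quotient_map_wedge_sum[OF False]])
    show "continuous_map (sum_topology X I) (X i) (r i \<circ> (\<lambda>(i, y). if y = p i then None else Some (i, y)))"
    proof (rule continuous_map_from_sum_topology)
      fix j
      have "(\<lambda>x. (r i \<circ> (\<lambda>(i, y). if y = p i then None else Some (i, y))) (j, x)) = (if j = i then (\<lambda>x. x) else (\<lambda>_. p i))"
        by (auto simp: r_def)
      then show "continuous_map (X j) (X i) (\<lambda>x. (r i \<circ> (\<lambda>(i, y). if y = p i then None else Some (i, y))) (j, x))"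
        using p[OF i] by auto
    qed
  qed
  show ?thesis
  proof (rule Hausdorff_space_injective_preimage)
    show "Hausdorff_space (product_topology X I)" using X by (simp add: Hausdorff_space_product_topology)
    show "continuous_map (wedge_sum I X p) (product_topology X I) (\<lambda>z. \<lambda>i\<in>I. r i z)"
      using cont by (auto simp: continuous_map_componentwise)
    show "inj_on (\<lambda>z. \<lambda>i\<in>I. r i z) (topspace (wedge_sum I X p))"
    proof (rule inj_onI)
      fix z w
      assume z: "z \<in> topspace (wedge_sum I X p)" and w: "w \<in> topspace (wedge_sum I X p)"
        and eq: "(\<lambda>i\<in>I. r i z) = (\<lambda>i\<in>I. r i w)"
      have eq': "r i z = r i w" if "i \<in> I" for i using fun_cong[OF eq, of i] that by simp
      show "z = w"
      proof (cases z)
        case None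
        show ?thesis
        proof (cases w)
          case (Some k)
          obtain i y where "k = (i, y)" by (cases k)
          then show ?thesis using eq'[of i] w p None Some by (auto simp: r_def topspace_wedge_sum)
        qed (simp add: None)
      next
        case (Some k)
        obtain i y where k: "k = (i, y)" by (cases k)
        then have i: "i \<in> I" "y \<noteq> p i" using z p Some by (auto simp: topspace_wedge_sum)
        then show ?thesis using eq'[OF i(1)] Some k by (auto simp: r_def split: option.splits if_splits)
      qed
    qed
  qed
qed

section \<open>Collapsing the complement of a set of facets\<close>

definition realization_points :: "'a set set \<Rightarrow> ('a \<Rightarrow> real) set" where
  "realization_points K = {x. (\<forall>a. 0 \<le> x a) \<and> {a. x a \<noteq> 0} \<in> K \<and> (\<Sum>a | x a \<noteq> 0. x a) = 1}"

lemma geometric_realization_eq: "geometric_realization K = top_of_set (realization_points K)"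
  by (simp add: geometric_realization_def realization_points_def euclidean_product_topology)

section \<open>Realizations of finite complexes: compactness and straight-line homotopies\<close>

locale finite_complex =
  fixes E :: "'a set" and K :: "'a set set"
  assumes finite_vertices: "finite E"
    and face_subset: "H \<in> K \<Longrightarrow> H \<subseteq> E"
    and face_down: "H \<in> K \<Longrightarrow> G \<subseteq> H \<Longrightarrow> G \<in> K"
begin

lemma finite_faces: "finite K"
  using finite_vertices face_subset by (metis PowI finite_Pow_iff finite_subset subsetI)

text \<open>The index set of the original sum varies with the point. Summing over the fixed finite
  set \<open>E\<close> makes the condition visibly continuous.\<close>

lemma realization_points_iff:
  "x \<in> realization_points K \<longleftrightarrow> (\<forall>a. 0 \<le> x a) \<and> {a. x a \<noteq> 0} \<in> K \<and> sum x E = 1"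
proof -
  have "(\<Sum>a | x a \<noteq> 0. x a) = sum x E" if "{a. x a \<noteq> 0} \<in> K"
    using face_subset[OF that] finite_vertices by (intro sum.mono_neutral_left) auto
  then show ?thesis unfolding realization_points_def by auto
qed

lemma realization_points_out: "x \<in> realization_points K \<Longrightarrow> a \<notin> E \<Longrightarrow> x a = 0"
  using face_subset unfolding realization_points_iff by auto

lemma closed_simplex: "closed {x. (\<forall>a. 0 \<le> x a) \<and> (\<forall>a\<in>-H. x a = 0) \<and> sum x E = (1::real)}"
  unfolding Collect_conj_eq Collect_all_eq Collect_ball_eq
  by (intro closed_Int closed_INT closed_Collect_le closed_Collect_eq ballI continuous_intros
      continuous_on_product_coordinates; simp)

text \<open>Having support inside a given face is a closed condition, unlike having it as support.
  Downward closure makes the two descriptions agree after taking the union over all faces.\<close>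

lemma realization_points_Union:
  "realization_points K = (\<Union>H\<in>K. {x. (\<forall>a. 0 \<le> x a) \<and> (\<forall>a\<in>-H. x a = 0) \<and> sum x E = 1})"
proof -
  have *: "{a. x a \<noteq> 0} \<in> K \<longleftrightarrow> (\<exists>H\<in>K. \<forall>a\<in>-H. x a = 0)" for x :: "'a \<Rightarrow> real"
    by (auto intro: face_down)
  show ?thesis unfolding set_eq_iff realization_points_iff * by auto
qed

lemma closed_realization_points: "closed (realization_points K)"
  unfolding realization_points_Union using finite_faces closed_simplex by blast

lemma compact_realization_points: "compact (realization_points K)"
proof -
  have "compactin (powertop_real UNIV) (Pi\<^sub>E UNIV (\<lambda>_::'a. {0..1::real}))"
    by (simp add: compactin_PiE)
  then have "compact (Pi\<^sub>E UNIV (\<lambda>_::'a. {0..1::real}))"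
    by (simp add: euclidean_product_topology)
  moreover have "realization_points K \<subseteq> Pi\<^sub>E UNIV (\<lambda>_. {0..1})"
  proof
    fix x assume x: "x \<in> realization_points K"
    have "x a \<le> 1" for a
    proof (cases "a \<in> E")
      case True
      then have "x a \<le> sum x E"
        using x finite_vertices by (intro member_le_sum) (auto simp: realization_points_iff)
      then show ?thesis using x by (simp add: realization_points_iff)
    qed (use realization_points_out[OF x] in simp)
    then show "x \<in> Pi\<^sub>E UNIV (\<lambda>_. {0..1})" using x by (auto simp: realization_points_iff)
  qed
  ultimately show ?thesis
    using closed_realization_points by (metis compact_Int_closed inf.absorb_iff2)
qed

lemma segment_in_realization_points:
  assumes "\<And>a. 0 \<le> x a" "\<And>a. 0 \<le> y a" "sum x E = 1" "sum y E = 1"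
    and "{a. x a \<noteq> 0} \<union> {a. y a \<noteq> 0} \<in> K" and t: "t \<in> {0..1}"
  shows "(\<lambda>a. (1 - t) * x a + t * y a) \<in> realization_points K"
proof -
  have "{a. (1 - t) * x a + t * y a \<noteq> 0} \<subseteq> {a. x a \<noteq> 0} \<union> {a. y a \<noteq> 0}" by auto
  then have "{a. (1 - t) * x a + t * y a \<noteq> 0} \<in> K" using assms(5) face_down by blast
  then show ?thesis
    using assms(1-4) t by (simp add: realization_points_iff sum.distrib flip: sum_distrib_left)
qed

text \<open>The segment from \<open>f x\<close> to \<open>g x\<close> lies in the simplex spanned by
  the union of the two supports. Requiring this union to be a face of \<open>L\<close> for points of
  \<open>L\<close> keeps \<open>L\<close> invariant at every time.\<close>

lemma homotopic_with_straight_line: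
  assumes L: "finite_complex E L" "L \<subseteq> K"
    and cont: "continuous_on (realization_points K) f" "continuous_on (realization_points K) g"
    and f: "\<And>x. x \<in> realization_points K \<Longrightarrow> f x \<in> realization_points K"
    and g: "\<And>x. x \<in> realization_points K \<Longrightarrow> g x \<in> realization_points K"
    and K: "\<And>x. x \<in> realization_points K \<Longrightarrow> {a. f x a \<noteq> 0} \<union> {a. g x a \<noteq> 0} \<in> K"
    and fgL: "\<And>x. x \<in> realization_points L \<Longrightarrow> {a. f x a \<noteq> 0} \<union> {a. g x a \<noteq> 0} \<in> L"
  shows "homotopic_with (\<lambda>h. h ` realization_points L \<subseteq> realization_points L)
           (geometric_realization K) (geometric_realization K) f g"
proof -
  interpret L: finite_complex E L by fact
  have LK: "realization_points L \<subseteq> realization_points K"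
    using L(2) by (auto simp: realization_points_def)
  define h where "h z = (\<lambda>a. (1 - fst z) * f (snd z) a + fst z * g (snd z) a)" for z :: "real \<times> ('a \<Rightarrow> real)"
  have hK: "h (t, x) \<in> realization_points K" if "t \<in> {0..1}" "x \<in> realization_points K" for t x
    unfolding h_def fst_conv snd_conv using that f[of x] g[of x] K[of x]
    by (intro segment_in_realization_points) (auto simp: realization_points_iff)
  have hL: "h (t, x) \<in> realization_points L" if "t \<in> {0..1}" "x \<in> realization_points L" for t x
    unfolding h_def fst_conv snd_conv using that f[of x] g[of x] fgL[of x] LK
    by (intro L.segment_in_realization_points) (auto simp: realization_points_iff)
  have coord: "continuous_on ({0..1} \<times> realization_points K) (\<lambda>z. k (snd z) a)"
    if "continuous_on (realization_points K) k" for k :: "('a \<Rightarrow> real) \<Rightarrow> 'a \<Rightarrow> real" and a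
    by (rule continuous_on_product_then_coordinatewise,
        rule continuous_on_compose2[OF that continuous_on_snd[OF continuous_on_id]]) auto
  have "continuous_on ({0..1} \<times> realization_points K) h"
    unfolding h_def
    by (rule continuous_on_coordinatewise_then_product)
       (intro continuous_on_add continuous_on_mult continuous_on_diff continuous_on_const
         continuous_on_fst continuous_on_id coord cont)
  then have "continuous_map (prod_topology (top_of_set {0..1}) (geometric_realization K)) (geometric_realization K) h"
    using hK by (auto simp: geometric_realization_eq)
  then show ?thesis
    unfolding homotopic_with_def
    by (intro exI[of _ h]) (use hL in \<open>auto simp: h_def\<close>)
qed

end

section \<open>Mapping a complex onto a wedge of spheres\<close>

lemma sphere_basepoint_in: "0 \<le> d \<Longrightarrow> sphere_basepoint \<in> topspace (sphere_space d)"
  using in_topspace_nsphere by (simp add: sphere_space_def sphere_basepoint_def)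

lemma Hausdorff_nsphere: "Hausdorff_space (nsphere d)"
  by (simp add: nsphere euclidean_product_topology Hausdorff_space_subtopology)

text \<open>Distinct facets in \<open>C\<close> meet only in faces outside \<open>C\<close>. Hence
  \<open>simplex_to_sphere\<close> can be used on each of them separately, with the rest of the
  complex sent to the base point.\<close>

theorem (in finite_complex) homotopy_equivalent_wedge_of_facets:
  fixes I :: "'i set"
  assumes CK: "C \<subseteq> K" and facet: "\<And>F H. \<lbrakk>F \<in> C; H \<in> K; F \<subseteq> H\<rbrakk> \<Longrightarrow> H = F"
    and nonempty: "{} \<notin> C"
    and b: "bij_betw b I C" and d: "\<And>i. i \<in> I \<Longrightarrow> d i = int (card (b i)) - 1"
    and hom: "homotopic_with (\<lambda>h. h ` realization_points (K - C) \<subseteq> realization_points (K - C))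
                (geometric_realization K) (geometric_realization K) id f"
    and f: "\<And>x. x \<in> realization_points (K - C) \<Longrightarrow> f x = p"
    and ne: "realization_points (K - C) \<noteq> {}"
  shows "geometric_realization K homotopy_equivalent_space wedge_of_spheres I d"
proof -
  let ?supp = "\<lambda>x::'a \<Rightarrow> real. {a. x a \<noteq> 0}"
  let ?A = "realization_points (K - C)"
  have bC: "b i \<in> C" if "i \<in> I" for i using b that by (auto simp: bij_betw_def)
  have finI: "finite I"
    using b CK finite_faces by (meson bij_betw_finite finite_subset)
  interpret A: finite_complex E "K - C"
  proof
    show "G \<in> K - C" if "H \<in> K - C" "G \<subseteq> H" for G H
      using that facet[of G H] by (auto intro: face_down)
  qed (use finite_vertices face_subset in auto)
  have bfin: "finite (b i)" "b i \<noteq> {}" "b i \<subseteq> E" if "i \<in> I" for i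
  proof -
    show "b i \<subseteq> E" using bC[OF that] CK face_subset by blast
    then show "finite (b i)" using finite_vertices finite_subset by blast
    show "b i \<noteq> {}" using bC[OF that] nonempty by metis
  qed
  define n where "n i = card (b i) - 1" for i
  have "\<exists>g. bij_betw g {..n i} (b i)" if "i \<in> I" for i
  proof -
    have "card (b i) > 0" using bfin[OF that] by (simp add: card_gt_0_iff)
    then have "{..n i} = {0..<card (b i)}" by (auto simp: n_def)
    then show ?thesis using ex_bij_betw_nat_finite[OF bfin(1)[OF that]] by simp
  qed
  then obtain g where g: "\<And>i. i \<in> I \<Longrightarrow> bij_betw (g i) {..n i} (b i)" by metis
  have dn: "d i = int (n i)" if "i \<in> I" for i
    using d[OF that] bfin[OF that] by (simp add: n_def card_gt_0_iff Suc_leI of_nat_diff)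
  define s where "s i x = simplex_to_sphere (n i) (x \<circ> g i)" for i and x :: "'a \<Rightarrow> real"
  let ?P = "\<lambda>i (x::'a \<Rightarrow> real). Min ((x \<circ> g i) ` {..n i})"
  have Pimg: "(x \<circ> g i) ` {..n i} = x ` b i" if "i \<in> I" for i and x :: "'a \<Rightarrow> real"
    using g[OF that] by (auto simp: bij_betw_def simp flip: image_image image_comp)
  have sumg: "(\<Sum>j\<le>n i. (x \<circ> g i) j) = sum x (b i)" if "i \<in> I" for i and x :: "'a \<Rightarrow> real"
    using sum.reindex_bij_betw[OF g[OF that], of x] by simp
  have Ppos: "?P i x > 0" if "i \<in> I" "x \<in> realization_points K" "?supp x = b i" for i x
    using that bfin[OF that(1)] unfolding Pimg[OF that(1)]
    by (subst Min_gr_iff) (auto simp: realization_points_iff less_le)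
  have sum1: "sum x (b i) = 1" if "i \<in> I" "x \<in> realization_points K" "?supp x \<subseteq> b i" for i x
  proof -
    have "sum x (b i) = sum x E" using that bfin[OF that(1)] finite_vertices by (intro sum.mono_neutral_left) auto
    then show ?thesis using that by (simp add: realization_points_iff)
  qed
  have Pzero: "?P i x = 0" if "i \<in> I" "x \<in> realization_points K" "?supp x \<noteq> b i" for i x
  proof -
    \<comment> \<open>Here the facet property enters: a different face cannot contain
      \<open>b i\<close>, so it misses a vertex of it and the least coordinate is 0.\<close>
    have "\<not> b i \<subseteq> ?supp x" using facet[OF bC[OF that(1)], of "?supp x"] that(2,3) by (auto simp: realization_points_iff)
    then obtain a where "a \<in> b i" "x a = 0" by auto
    then show ?thesis using that(2) bfin[OF that(1)] unfolding Pimg[OF that(1)]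
      by (intro Min_eqI) (auto simp: realization_points_iff intro!: rev_image_eqI)
  qed
  have s_base: "s i x = sphere_basepoint" if "i \<in> I" "x \<in> realization_points K" "?supp x \<noteq> b i" for i x
    unfolding s_def using Pzero[OF that] by (rule simplex_to_sphere_boundary)
  have s_int: "s i x \<noteq> sphere_basepoint" if "i \<in> I" "x \<in> realization_points K" "?supp x = b i" for i x
    using simplex_to_sphere_interior(1)[OF Ppos[OF that]] by (auto simp: s_def sphere_basepoint_def)
  have s_in: "s i x \<in> topspace (nsphere (n i))" if "i \<in> I" "x \<in> realization_points K" for i x
  proof (cases "?supp x = b i")
    case True
    then have "(\<Sum>j\<le>n i. (x \<circ> g i) j) = 1" using sumg sum1 that by (metis subset_refl)
    then show ?thesis unfolding s_def by (intro simplex_to_sphere_in_nsphere) simp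
  next
    case False
    then show ?thesis unfolding s_def using Pzero[OF that] by (intro simplex_to_sphere_in_nsphere) simp
  qed
  define q where "q x = (if \<exists>i\<in>I. ?supp x = b i then let i = the_inv_into I b (?supp x) in Some (i, s i x) else None)" for x
  have inv: "the_inv_into I b (b i) = i" if "i \<in> I" for i
    using b that by (simp add: bij_betw_def the_inv_into_f_f)
  have q_int: "q x = Some (i, s i x)" if "i \<in> I" "?supp x = b i" for i x
    using that inv by (auto simp: q_def)
  have q_A: "q x = None" if "x \<in> ?A" for x
    using that bC by (auto simp: q_def A.realization_points_iff)
  have q_cases: "x \<in> ?A \<or> (\<exists>i\<in>I. ?supp x = b i)" if "x \<in> realization_points K" for x
  proof (cases "?supp x \<in> C")
    case True
    then show ?thesis using b by (auto simp: bij_betw_def)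
  next
    case False
    then show ?thesis using that by (auto simp: A.realization_points_iff realization_points_iff)
  qed
  let ?Y = "wedge_of_spheres I d"
  have X: "sphere_space (d i) = nsphere (n i)" if "i \<in> I" for i
    using dn[OF that] by (simp add: sphere_space_def)
  have base: "sphere_basepoint \<in> topspace (sphere_space (d i))" if "i \<in> I" for i
    using dn[OF that] by (intro sphere_basepoint_in) simp
  have topY: "topspace ?Y = insert None (Some ` (SIGMA i:I. topspace (sphere_space (d i)) - {sphere_basepoint}))"
    unfolding wedge_of_spheres_def by (rule topspace_wedge_sum) (rule base)
  have cont_q: "continuous_map (geometric_realization K) ?Y q"
  \<comment> \<open>The collapsed part and the closed simplices of the facets in \<open>C\<close>
    form a finite closed cover. Every piece carries the same function \<open>q\<close>, so agreement
    on overlaps is automatic.\<close>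
  proof (rule pasting_lemma_closed[where I = "insert None (Some ` I)"
        and T = "\<lambda>k. case k of None \<Rightarrow> ?A | Some i \<Rightarrow> {x \<in> realization_points K. ?supp x \<subseteq> b i}"
        and f = "\<lambda>_. q"])
    show "finite (insert None (Some ` I))" using finI by simp
    show "closedin (geometric_realization K) (case k of None \<Rightarrow> ?A | Some i \<Rightarrow> {x \<in> realization_points K. ?supp x \<subseteq> b i})"
      for k
    proof (cases k)
      case None
      have "?A \<subseteq> realization_points K" by (auto simp: realization_points_def)
      then show ?thesis using None A.closed_realization_points
        by (simp add: geometric_realization_eq closed_subset)
    next
      case (Some i)
      have "closed {x::'a \<Rightarrow> real. \<forall>a\<in>-b i. x a = 0}"
        unfolding Collect_ball_eq
        by (intro closed_INT closed_Collect_eq ballI continuous_intros continuous_on_product_coordinates)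
      moreover have "{x \<in> realization_points K. ?supp x \<subseteq> b i} = realization_points K \<inter> {x::'a \<Rightarrow> real. \<forall>a\<in>-b i. x a = 0}"
        by auto
      ultimately show ?thesis
        using Some closed_realization_points by (auto simp: geometric_realization_eq intro!: closed_subset)
    qed
    show "continuous_map (subtopology (geometric_realization K)
        (case k of None \<Rightarrow> ?A | Some i \<Rightarrow> {x \<in> realization_points K. ?supp x \<subseteq> b i})) ?Y q"
      if k: "k \<in> insert None (Some ` I)" for k
    proof (cases k)
      case None
      show ?thesis
        by (rule continuous_map_eq[of _ _ "\<lambda>_. None"])
           (auto simp: None q_A topY geometric_realization_eq)
    next
      case (Some i)
      then have i: "i \<in> I" using k by auto
      let ?S = "{x \<in> realization_points K. ?supp x \<subseteq> b i}"
      have "continuous_on ?S (s i)"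
        unfolding s_def comp_def
        by (intro continuous_on_compose2[OF continuous_on_simplex_to_sphere]
              continuous_on_coordinatewise_then_product
              continuous_on_subset[OF continuous_on_product_coordinates]) auto
      then have "continuous_map (top_of_set ?S) (nsphere (n i)) (s i)"
        using s_in[OF i] by (auto simp: nsphere euclidean_product_topology)
      from continuous_map_compose[OF this[folded X[OF i]]
          continuous_map_wedge_inclusion[OF i, of "\<lambda>i. sphere_space (d i)" "\<lambda>_. sphere_basepoint"]]
      have incl: "continuous_map (top_of_set ?S) ?Y (\<lambda>x. if s i x = sphere_basepoint then None else Some (i, s i x))"
        by (simp add: o_def wedge_of_spheres_def)
      have q_S: "q x = (if s i x = sphere_basepoint then None else Some (i, s i x))" if x: "x \<in> ?S" for x
      proof (cases "?supp x = b i")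
        case True
        then show ?thesis using q_int[OF i True] s_int[OF i _ True] x by simp
      next
        case False
        \<comment> \<open>A member of \<open>C\<close> strictly inside \<open>b i\<close> would
          contradict its own maximality, so both descriptions of \<open>q\<close> give the base
          point here.\<close>
        have "?supp x \<notin> C" using facet[of "?supp x" "b i"] False x bC[OF i] CK by auto
        then have "q x = None" using bC by (auto simp: q_def)
        then show ?thesis using s_base[OF i _ False] x by simp
      qed
      have "continuous_map (top_of_set ?S) ?Y q"
        by (rule continuous_map_eq[OF incl]) (simp add: q_S)
      moreover have "realization_points K \<inter> ?S = ?S" by auto
      ultimately show ?thesis
        by (simp add: Some geometric_realization_eq subtopology_subtopology)
    qed
    show "\<exists>j. j \<in> insert None (Some ` I) \<and>
        x \<in> (case j of None \<Rightarrow> ?A | Some i \<Rightarrow> {x \<in> realization_points K. ?supp x \<subseteq> b i}) \<and> q x = q x"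
      if "x \<in> topspace (geometric_realization K)" for x
      using q_cases[of x] that by (auto simp: geometric_realization_eq intro: exI[of _ None] exI[of _ "Some _"])
  qed auto
  have surj: "q ` topspace (geometric_realization K) = topspace ?Y"
  proof
    show "q ` topspace (geometric_realization K) \<subseteq> topspace ?Y"
      using cont_q by (rule continuous_map_image_subset_topspace)
    show "topspace ?Y \<subseteq> q ` topspace (geometric_realization K)"
    proof
      fix z assume "z \<in> topspace ?Y"
      then consider "z = None" | i y where "z = Some (i, y)" "i \<in> I" "y \<in> topspace (nsphere (n i))" "y \<noteq> sphere_basepoint"
        unfolding topY using X by (auto; blast)
      then show "z \<in> q ` topspace (geometric_realization K)"
      proof cases
        case 1
        \<comment> \<open>Only points of \<open>?A\<close> are sent to \<open>None\<close>, so
          surjectivity rests on \<open>ne\<close>.\<close>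
        obtain x where "x \<in> ?A" using ne by auto
        then have "q x = z" "x \<in> realization_points K" using q_A 1 by (auto simp: realization_points_def)
        then show ?thesis by (auto simp: geometric_realization_eq)
      next
        case 2
        obtain v where v: "Min (v ` {..n i}) > 0" "(\<Sum>j\<le>n i. v j) = 1" "simplex_to_sphere (n i) v = y"
          using simplex_to_sphere_surj[OF 2(3,4)] .
        have vpos: "v j > 0" if "j \<le> n i" for j
          using v(1) that by (subst (asm) Min_gr_iff) auto
        define x where "x a = (if a \<in> b i then v (the_inv_into {..n i} (g i) a) else 0)" for a
        have gi: "inj_on (g i) {..n i}" "g i ` {..n i} = b i" using g[OF 2(2)] by (auto simp: bij_betw_def)
        have xg: "x (g i j) = v j" if "j \<le> n i" for j
          using gi that by (auto simp: x_def the_inv_into_f_f)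
        have xpos: "x a > 0" if "a \<in> b i" for a
          using that gi(2) xg vpos by (metis atMost_iff imageE)
        have supp: "?supp x = b i" using xpos by (force simp: x_def)
        have "sum x E = sum x (b i)"
          using bfin[OF 2(2)] finite_vertices by (intro sum.mono_neutral_right) (auto simp: x_def)
        also have "\<dots> = (\<Sum>j\<le>n i. (x \<circ> g i) j)" using sumg[OF 2(2)] by simp
        also have "\<dots> = 1" using xg v(2) by simp
        finally have "sum x E = 1" .
        moreover have "0 \<le> x a" for a using xpos[of a] by (cases "a \<in> b i") (auto simp: x_def)
        ultimately have xK: "x \<in> realization_points K"
          using supp bC[OF 2(2)] CK by (auto simp: realization_points_iff)
        \<comment> \<open>The two vectors are known to agree only at indices up to
          \<open>n i\<close>, which are the only ones that \<open>simplex_to_sphere\<close>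
          reads.\<close>
        have "simplex_to_sphere (n i) (x \<circ> g i) = simplex_to_sphere (n i) v"
        proof -
          have "(x \<circ> g i) ` {..n i} = v ` {..n i}" using xg by (auto intro!: image_cong)
          moreover have "(\<Sum>j\<le>n i. (x \<circ> g i) j) = (\<Sum>j\<le>n i. v j)" using xg by (auto intro!: sum.cong)
          moreover have "(\<Sum>j=1..n i. ((x \<circ> g i) j - (x \<circ> g i) 0)\<^sup>2) = (\<Sum>j=1..n i. (v j - v 0)\<^sup>2)"
            using xg by (auto intro!: sum.cong)
          ultimately show ?thesis
            using xg by (auto simp: simplex_to_sphere_def Let_def fun_eq_iff)
        qed
        then have "q x = z" using q_int[OF 2(2) supp] 2 v(3) by (simp add: s_def)
        then show ?thesis using xK by (auto simp: geometric_realization_eq)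
      qed
    qed
  qed
  show ?thesis
  proof (rule homotopy_equivalent_space_collapse[OF _ _ cont_q surj hom f])
    show "compact_space (geometric_realization K)"
      using compact_realization_points by (simp add: geometric_realization_eq compact_space_subtopology)
    show "Hausdorff_space ?Y"
      unfolding wedge_of_spheres_def using X base Hausdorff_nsphere by (intro Hausdorff_space_wedge_sum) auto
    show "q x = q y" if "x \<in> ?A" "y \<in> ?A" for x y using q_A that by simp
    show "x = y \<or> x \<in> ?A \<and> y \<in> ?A"
      if "x \<in> topspace (geometric_realization K)" "y \<in> topspace (geometric_realization K)" "q x = q y" for x y
    proof -
      note qxy = that(3)
      have xK: "x \<in> realization_points K" and yK: "y \<in> realization_points K"
        using that by (auto simp: geometric_realization_eq)
      show ?thesis
      proof (cases "q x")
        case None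
        then show ?thesis using q_cases[OF xK] q_cases[OF yK] q_int qxy by force
      next
        case (Some z)
        then obtain i where i: "i \<in> I" "?supp x = b i" using q_cases[OF xK] q_A by force
        obtain j where j: "j \<in> I" "?supp y = b j" using q_cases[OF yK] q_A Some qxy by force
        have ij: "j = i" and seq: "s i x = s i y" using qxy q_int[OF i] q_int[OF j] by auto
        have yi: "?supp y = b i" using j ij by simp
        have eq: "(x \<circ> g i) k = (y \<circ> g i) k" if "k \<le> n i" for k
        proof (rule simplex_to_sphere_inj)
          show "?P i x > 0" "?P i y > 0" using Ppos i yi xK yK by auto
          show "(\<Sum>j\<le>n i. (x \<circ> g i) j) = 1" "(\<Sum>j\<le>n i. (y \<circ> g i) j) = 1"
            using sumg[OF i(1)] sum1[OF i(1)] xK yK i yi by auto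
        qed (use seq that in \<open>auto simp: s_def comp_def\<close>)
        have "x a = y a" for a
        proof (cases "a \<in> b i")
          case True
          then obtain k where "k \<le> n i" "a = g i k" using g[OF i(1)] by (auto simp: bij_betw_def)
          then show ?thesis using eq by simp
        next
          case False
          then show ?thesis using i(2) yi by (metis (mono_tags, lifting) mem_Collect_eq)
        qed
        then show ?thesis by blast
      qed
    qed
  qed
qed

section \<open>Complexes defined by degree bounds\<close>

text \<open>\<open>B i\<close> models the edges at the \<open>i\<close>-th constrained vertex. An
  edge may lie in several of these sets, but \<open>a i\<close> is private to the constraint
  \<open>i\<close>.\<close>

locale degree_complex =
  fixes E :: "'a set" and J :: "'j set" and B :: "'j \<Rightarrow> 'a set" and a :: "'j \<Rightarrow> 'a" and l :: "'j \<Rightarrow> nat"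
  assumes finite_E: "finite E" and finite_J: "finite J" and E_eq: "E = (\<Union>i\<in>J. B i)"
    and a_in: "i \<in> J \<Longrightarrow> a i \<in> B i"
    and a_notin: "\<lbrakk>i \<in> J; j \<in> J; i \<noteq> j\<rbrakk> \<Longrightarrow> a i \<notin> B j"
begin

definition faces :: "'a set set" where
  "faces = {H. H \<subseteq> E \<and> (\<forall>i\<in>J. card (H \<inter> B i) \<le> l i)}"

definition critical :: "'a set set" where
  "critical = {F. F \<subseteq> E \<and> (\<forall>i\<in>J. a i \<notin> F \<and> card (F \<inter> B i) = l i)}"

lemma B_sub: "i \<in> J \<Longrightarrow> B i \<subseteq> E"
  using E_eq by blast

lemma finite_sub: "H \<subseteq> E \<Longrightarrow> finite H"
  using finite_E finite_subset by blast

text \<open>The sets \<open>B i\<close> cover \<open>E\<close>, so any further edge would exceed a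
  bound that \<open>F\<close> already attains.\<close>

lemma critical_facet:
  assumes F: "F \<in> critical" and H: "H \<in> faces" and FH: "F \<subseteq> H"
  shows "H = F"
proof (rule ccontr)
  assume "H \<noteq> F"
  then obtain e where e: "e \<in> H" "e \<notin> F" using FH by auto
  have "e \<in> E" using e H by (auto simp: faces_def)
  then obtain i where i: "i \<in> J" "e \<in> B i" unfolding E_eq by blast
  have "F \<inter> B i \<subset> H \<inter> B i" using FH e i by auto
  moreover have "finite (H \<inter> B i)" using H finite_sub by (auto simp: faces_def)
  ultimately have "card (F \<inter> B i) < card (H \<inter> B i)" by (rule psubset_card_mono[rotated])
  then show False using F H i by (auto simp: faces_def critical_def)
qed

sublocale faces: finite_complex E faces
proof
  fix H G assume H: "H \<in> faces" and G: "G \<subseteq> H"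
  have "card (G \<inter> B i) \<le> l i" if "i \<in> J" for i
  proof -
    have "card (G \<inter> B i) \<le> card (H \<inter> B i)"
      using H G finite_sub by (intro card_mono) (auto simp: faces_def)
    then show ?thesis using H that by (auto simp: faces_def)
  qed
  then show "G \<in> faces" using H G by (auto simp: faces_def)
qed (auto simp: faces_def finite_E)

sublocale noncritical: finite_complex E "faces - critical"
proof
  fix H G assume "H \<in> faces - critical" "G \<subseteq> H"
  then show "G \<in> faces - critical" using faces.face_down critical_facet by blast
qed (auto simp: faces_def finite_E)

lemma critical_subset: "critical \<subseteq> faces"
  by (auto simp: critical_def faces_def)

text \<open>Discounting \<open>a i\<close> in the slack condition treats the cases
  \<open>a i \<in> G\<close> and \<open>a i \<notin> G\<close> alike. Since \<open>a i\<close>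
  affects no constraint but its own, several special vertices can be added at once.\<close>

lemma add_special:
  assumes G: "G \<in> faces" and S: "S \<subseteq> J" and slack: "\<And>i. i \<in> S \<Longrightarrow> card (G \<inter> B i - {a i}) < l i"
  shows "G \<union> a ` S \<in> faces"
proof -
  have "card ((G \<union> a ` S) \<inter> B i) \<le> l i" if i: "i \<in> J" for i
  proof (cases "i \<in> S")
    case True
    have fin: "finite (G \<inter> B i)" using G finite_sub by (auto simp: faces_def)
    have "(G \<union> a ` S) \<inter> B i \<subseteq> insert (a i) (G \<inter> B i - {a i})"
      using a_notin S i by auto
    then have "card ((G \<union> a ` S) \<inter> B i) \<le> card (insert (a i) (G \<inter> B i - {a i}))"
      using fin by (intro card_mono) auto
    also have "\<dots> = Suc (card (G \<inter> B i - {a i}))"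
      using fin by (intro card_insert_disjoint) auto
    also have "\<dots> \<le> l i" using slack[OF True] by simp
    finally show ?thesis .
  next
    case False
    then have "(G \<union> a ` S) \<inter> B i = G \<inter> B i" using a_notin S i by auto
    then show ?thesis using G i by (simp add: faces_def)
  qed
  moreover have "a ` S \<subseteq> E" using S a_in E_eq by auto
  ultimately show ?thesis using G by (auto simp: faces_def)
qed

text \<open>Either some \<open>a i\<close> belongs to \<open>H\<close>, and removing it lowers a
  count that was within its bound, or some bound is not attained. By \<open>add_special\<close>,
  \<open>H\<close> then lies in the star of \<open>a i\<close>.\<close>

lemma noncritical_slack:
  assumes H: "H \<in> faces - critical"
  obtains i where "i \<in> J" "card (H \<inter> B i - {a i}) < l i"
proof -
  obtain i where i: "i \<in> J" "a i \<in> H \<or> card (H \<inter> B i) \<noteq> l i"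
    using H by (auto simp: critical_def faces_def)
  have le: "card (H \<inter> B i) \<le> l i" using H i by (auto simp: faces_def)
  have fin: "finite (H \<inter> B i)" using H finite_sub by (auto simp: faces_def)
  show ?thesis
  proof (cases "a i \<in> H")
    case True
    then have "card (H \<inter> B i - {a i}) < card (H \<inter> B i)"
      using a_in[OF i(1)] fin by (intro card_Diff1_less) auto
    then show ?thesis using that i le by simp
  next
    case False
    then have "H \<inter> B i - {a i} = H \<inter> B i" by auto
    then show ?thesis using that[OF i(1)] i False le by simp
  qed
qed

text \<open>
  Coordinates below \<open>thr\<close> are cut off first. Afterwards the vertex \<open>a i\<close> may be added to the support
  as soon as \<open>weight i\<close> is positive, because the elementary symmetric polynomial \<open>esym i\<close> being below
  \<open>eps\<close> leaves fewer than \<open>l i\<close> surviving coordinates in \<open>B i - {a i}\<close>. Cutting off makes this an open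
  condition, so that the weights can be chosen continuously.
\<close>

definition thr :: real where "thr = 1 / (2 * real (card E))"

text \<open>A lower bound for any product of at most \<open>card E\<close> factors that are at least
  \<open>thr\<close>, because \<open>thr \<le> 1\<close>.\<close>

definition eps :: real where "eps = thr ^ card E"

definition esym :: "'j \<Rightarrow> ('a \<Rightarrow> real) \<Rightarrow> real" where
  "esym i x = (\<Sum>S | S \<subseteq> B i - {a i} \<and> card S = l i. \<Prod>e\<in>S. x e)"

definition weight :: "'j \<Rightarrow> ('a \<Rightarrow> real) \<Rightarrow> real" where
  "weight i x = max 0 (eps - esym i x)"

definition total :: "('a \<Rightarrow> real) \<Rightarrow> real" where
  "total x = (\<Sum>i\<in>J. weight i x)"

definition truncate :: "('a \<Rightarrow> real) \<Rightarrow> 'a \<Rightarrow> real" where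
  "truncate x = (\<lambda>e. max 0 (x e - thr) / (\<Sum>e\<in>E. max 0 (x e - thr)))"

text \<open>The maximum with \<open>eps / 2\<close> avoids division by zero where all weights
  vanish. As soon as \<open>total x\<close> reaches \<open>eps / 2\<close>, the truncated part has
  coefficient 0 and only special vertices remain.\<close>

definition push :: "('a \<Rightarrow> real) \<Rightarrow> 'a \<Rightarrow> real" where
  "push x = (\<lambda>e. (1 - total x / max (total x) (eps / 2)) * truncate x e
     + (\<Sum>i\<in>J. if a i = e then weight i x else 0) / max (total x) (eps / 2))"

text \<open>The coefficient of \<open>a k\<close> is 0 up to \<open>total x = eps / 2\<close>, so it
  starts only when \<open>push x\<close> consists of special vertices. It reaches 1 at
  \<open>total x = eps\<close>, a value attained or exceeded on the whole noncritical part.\<close>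

definition gather :: "'j \<Rightarrow> ('a \<Rightarrow> real) \<Rightarrow> 'a \<Rightarrow> real" where
  "gather k x = (\<lambda>e. (1 - max 0 (min 1 (2 * total x / eps - 1))) * push x e
     + max 0 (min 1 (2 * total x / eps - 1)) * (if e = a k then 1 else 0))"

section \<open>Supports, continuity and homotopies of the contraction\<close>

context
  fixes k assumes k: "k \<in> J" "0 < l k"
begin

text \<open>The vertex \<open>a k\<close> makes \<open>E\<close> nonempty; for empty
  \<open>E\<close> division by zero would give \<open>thr = 0\<close>.\<close>

lemma thr_pos: "0 < thr" and thr_le_1: "thr \<le> 1" and card_thr: "real (card E) * thr = 1 / 2"
proof -
  have "E \<noteq> {}" using k a_in E_eq by auto
  then have "card E > 0" using finite_E by (simp add: card_gt_0_iff)
  then show "0 < thr" "thr \<le> 1" "real (card E) * thr = 1 / 2"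
    by (auto simp: thr_def field_simps)
qed

lemma eps_pos: "0 < eps"
  using thr_pos by (simp add: eps_def)

lemma finite_subsets: "i \<in> J \<Longrightarrow> finite {S. S \<subseteq> B i - {a i} \<and> card S = l i}"
  by (rule finite_subset[of _ "Pow E"]) (use B_sub finite_E in auto)

text \<open>The choice of \<open>thr\<close> pays off: if no coordinate exceeded it, the total would
  be at most \<open>1 / 2\<close>.\<close>

lemma truncate_sum_pos:
  assumes x: "x \<in> realization_points faces"
  shows "0 < (\<Sum>e\<in>E. max 0 (x e - thr))"
proof -
  have "\<exists>e\<in>E. x e > thr"
  proof (rule ccontr)
    assume "\<not> ?thesis"
    then have "sum x E \<le> (\<Sum>e\<in>E. thr)" by (intro sum_mono) auto
    then show False using x card_thr by (simp add: faces.realization_points_iff)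
  qed
  then obtain e where e: "e \<in> E" "x e > thr" by auto
  then show ?thesis using finite_E by (intro sum_pos2[of E e]) auto
qed

lemma truncate_supp:
  assumes x: "x \<in> realization_points faces"
  shows "{e. truncate x e \<noteq> 0} = {e. x e > thr}"
  using truncate_sum_pos[OF x] by (auto simp: truncate_def max_def)

lemma truncate_supp_subset:
  assumes x: "x \<in> realization_points faces"
  shows "{e. truncate x e \<noteq> 0} \<subseteq> {e. x e \<noteq> 0}"
  using truncate_supp[OF x] thr_pos by auto

lemma truncate_in:
  assumes x: "x \<in> realization_points faces"
  shows "truncate x \<in> realization_points faces"
proof -
  have "{e. truncate x e \<noteq> 0} \<in> faces"
    using truncate_supp_subset[OF x] x faces.face_down by (auto simp: faces.realization_points_iff)
  moreover have "sum (truncate x) E = 1"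
    using truncate_sum_pos[OF x] by (simp add: truncate_def flip: sum_divide_distrib)
  moreover have "0 \<le> truncate x e" for e
    using truncate_sum_pos[OF x] by (simp add: truncate_def)
  ultimately show ?thesis by (simp add: faces.realization_points_iff)
qed

lemma weight_nonneg: "0 \<le> weight i x"
  by (simp add: weight_def)

text \<open>If \<open>l i\<close> coordinates survived, their product would be a summand of
  \<open>esym i x\<close> of size at least \<open>thr ^ l i\<close>, hence at least
  \<open>eps\<close>, and the weight would be 0. For \<open>l i = 0\<close> the summand is the empty
  product 1.\<close>

lemma weight_pos_slack:
  assumes x: "x \<in> realization_points faces" and i: "i \<in> J" and w: "0 < weight i x"
  shows "card ({e. truncate x e \<noteq> 0} \<inter> B i - {a i}) < l i"
proof (rule ccontr)
  assume "\<not> ?thesis"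
  then obtain S where S: "S \<subseteq> {e. truncate x e \<noteq> 0} \<inter> B i - {a i}" "card S = l i"
    by (meson not_le obtain_subset_with_card_n)
  have SE: "S \<subseteq> E" using S B_sub[OF i] by auto
  have nn: "0 \<le> x e" for e using x by (simp add: faces.realization_points_iff)
  have "eps \<le> thr ^ card S"
    unfolding eps_def using thr_pos thr_le_1 card_mono[OF finite_E SE] by (intro power_decreasing) auto
  also have "thr ^ card S = (\<Prod>e\<in>S. thr)" by simp
  also have "\<dots> \<le> (\<Prod>e\<in>S. x e)"
    using S(1) thr_pos by (intro prod_mono) (auto simp: truncate_supp[OF x])
  also have "\<dots> \<le> esym i x"
    unfolding esym_def using S nn finite_subsets[OF i]
    by (intro member_le_sum) (auto intro!: prod_nonneg)
  finally show False using w by (simp add: weight_def)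
qed

text \<open>With fewer than \<open>l i\<close> nonzero coordinates available, every product in
  \<open>esym i x\<close> has a zero factor.\<close>

lemma weight_eq_eps:
  assumes x: "x \<in> realization_points faces" and i: "i \<in> J" and slack: "card ({e. x e \<noteq> 0} \<inter> B i - {a i}) < l i"
  shows "weight i x = eps"
proof -
  have "(\<Prod>e\<in>S. x e) = 0" if S: "S \<subseteq> B i - {a i}" "card S = l i" for S
  proof -
    have "\<not> S \<subseteq> {e. x e \<noteq> 0} \<inter> B i - {a i}"
    proof
      assume sub: "S \<subseteq> {e. x e \<noteq> 0} \<inter> B i - {a i}"
      have "finite ({e. x e \<noteq> 0} \<inter> B i - {a i})"
        using B_sub[OF i] finite_sub by (meson Diff_subset Int_lower2 order_trans)
      from card_mono[OF this sub] show False using S slack by simp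
    qed
    then obtain e where "e \<in> S" "x e = 0" using S by auto
    moreover have "finite S" using S B_sub[OF i] finite_sub by blast
    ultimately show ?thesis by (auto intro: prod_zero)
  qed
  then have "esym i x = 0" by (auto simp: esym_def intro!: sum.neutral)
  then show ?thesis using eps_pos by (simp add: weight_def)
qed

lemma total_ge_eps:
  assumes x: "x \<in> realization_points (faces - critical)"
  shows "eps \<le> total x"
proof -
  have xK: "x \<in> realization_points faces" using x by (auto simp: realization_points_def)
  have "{e. x e \<noteq> 0} \<in> faces - critical" using x by (auto simp: realization_points_def)
  then obtain i where i: "i \<in> J" "card ({e. x e \<noteq> 0} \<inter> B i - {a i}) < l i"
    by (rule noncritical_slack)
  have "weight i x \<le> total x"
    unfolding total_def using i finite_J weight_nonneg by (intro member_le_sum) auto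
  then show ?thesis using weight_eq_eps[OF xK i] by simp
qed

lemma denominator_pos: "0 < max (total x) (eps / 2)"
  using eps_pos by (simp add: less_max_iff_disj)

lemma push_supp: "{e. push x e \<noteq> 0} \<subseteq> {e. truncate x e \<noteq> 0} \<union> a ` {i \<in> J. 0 < weight i x}"
proof
  fix e assume e: "e \<in> {e. push x e \<noteq> 0}"
  show "e \<in> {e. truncate x e \<noteq> 0} \<union> a ` {i \<in> J. 0 < weight i x}"
  proof (rule ccontr)
    assume no: "\<not> ?thesis"
    then have "(if a i = e then weight i x else 0) = 0" if "i \<in> J" for i
      using that weight_nonneg[of i x] by (auto simp: less_le)
    then have "(\<Sum>i\<in>J. if a i = e then weight i x else 0) = 0" by (intro sum.neutral) auto
    then show False using e no by (simp add: push_def)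
  qed
qed

lemma special_support_in_faces:
  assumes x: "x \<in> realization_points faces"
  shows "{e. truncate x e \<noteq> 0} \<union> a ` {i \<in> J. 0 < weight i x} \<in> faces"
  using truncate_in[OF x] weight_pos_slack[OF x]
  by (intro add_special) (auto simp: faces.realization_points_iff)

lemma special_support_noncritical:
  assumes x: "x \<in> realization_points (faces - critical)"
  shows "{e. truncate x e \<noteq> 0} \<union> a ` {i \<in> J. 0 < weight i x} \<in> faces - critical"
proof -
  have xK: "x \<in> realization_points faces" using x by (auto simp: realization_points_def)
  have "0 < total x" using total_ge_eps[OF x] eps_pos by simp
  then have "\<exists>i\<in>J. weight i x > 0"
    unfolding total_def by (meson not_less sum_nonpos)
  then show ?thesis
    using special_support_in_faces[OF xK] by (auto simp: critical_def)
qed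

lemma push_in:
  assumes x: "x \<in> realization_points faces"
  shows "push x \<in> realization_points faces"
proof -
  let ?M = "max (total x) (eps / 2)"
  have "{e. push x e \<noteq> 0} \<in> faces"
    using push_supp special_support_in_faces[OF x] faces.face_down by blast
  moreover have "0 \<le> push x e" for e
  proof -
    have "total x / ?M \<le> 1" using denominator_pos[of x] by (simp add: divide_le_eq_1)
    moreover have "0 \<le> truncate x e" using truncate_in[OF x] by (simp add: faces.realization_points_iff)
    moreover have "0 \<le> (\<Sum>i\<in>J. if a i = e then weight i x else 0) / ?M"
      using denominator_pos[of x] weight_nonneg by (intro divide_nonneg_pos sum_nonneg) auto
    ultimately show ?thesis by (simp add: push_def)
  qed
  moreover have "sum (push x) E = 1"
  proof -
    have "(\<Sum>e\<in>E. \<Sum>i\<in>J. if a i = e then weight i x else 0) = (\<Sum>i\<in>J. \<Sum>e\<in>E. if a i = e then weight i x else 0)"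
      by (rule sum.swap)
    also have "\<dots> = total x"
      unfolding total_def using finite_E a_in B_sub by (intro sum.cong) (auto simp: subset_iff)
    finally have "sum (push x) E = (1 - total x / ?M) * sum (truncate x) E + total x / ?M"
      by (simp add: push_def sum.distrib flip: sum_distrib_left sum_divide_distrib)
    then show ?thesis using truncate_in[OF x] by (simp add: faces.realization_points_iff)
  qed
  ultimately show ?thesis by (simp add: faces.realization_points_iff)
qed

lemma vertex_in: "(\<lambda>e. if e = a k then 1 else 0) \<in> realization_points (faces - critical)"
proof -
  have "{} \<in> faces" by (simp add: faces_def)
  then have "{} \<union> a ` {k} \<in> faces" using k by (intro add_special) auto
  then have "{a k} \<in> faces - critical" using k by (auto simp: critical_def)
  moreover have "a k \<in> E" using k a_in B_sub by blast
  ultimately show ?thesis using finite_E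
    by (simp add: noncritical.realization_points_iff)
qed

text \<open>If the coefficient of \<open>a k\<close> is 0, both maps agree at \<open>x\<close>.
  Otherwise \<open>push x\<close> lies in the simplex of all \<open>a i\<close> with
  \<open>l i > 0\<close>; that simplex also contains \<open>a k\<close>, which makes it
  noncritical.\<close>

lemma gather_supp:
  assumes x: "x \<in> realization_points faces"
  shows "{e. push x e \<noteq> 0} \<union> {e. gather k x e \<noteq> 0} \<in> faces"
    and "x \<in> realization_points (faces - critical) \<Longrightarrow> {e. push x e \<noteq> 0} \<union> {e. gather k x e \<noteq> 0} \<in> faces - critical"
proof -
  define c where "c = max 0 (min 1 (2 * total x / eps - 1))"
  have g: "gather k x = (\<lambda>e. (1 - c) * push x e + c * (if e = a k then 1 else 0))"
    by (simp add: gather_def c_def)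
  let ?U = "{e. push x e \<noteq> 0} \<union> {e. gather k x e \<noteq> 0}"
  have "?U \<in> faces \<and> (x \<in> realization_points (faces - critical) \<longrightarrow> ?U \<in> faces - critical)"
  proof (cases "c = 0")
    case True
    then have "?U = {e. push x e \<noteq> 0}" by (simp add: g)
    then show ?thesis
      using faces.face_down[OF special_support_in_faces[OF x] push_supp]
        noncritical.face_down[OF special_support_noncritical[of x] push_supp] by simp
  next
    case False
    then have "2 * total x / eps > 1" by (auto simp: c_def max_def split: if_splits)
    then have "total x > eps / 2" using eps_pos by (simp add: field_simps)
    then have "total x / max (total x) (eps / 2) = 1" using eps_pos by simp
    then have push: "push x = (\<lambda>e. (\<Sum>i\<in>J. if a i = e then weight i x else 0) / max (total x) (eps / 2))"
      by (simp add: push_def)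
    let ?T = "a ` {i \<in> J. 0 < l i}"
    have "{e. push x e \<noteq> 0} \<subseteq> ?T"
    proof
      fix e assume "e \<in> {e. push x e \<noteq> 0}"
      then have "(\<Sum>i\<in>J. if a i = e then weight i x else 0) \<noteq> 0" by (auto simp: push)
      then obtain i where "i \<in> J" "(if a i = e then weight i x else 0) \<noteq> 0" by (rule sum.not_neutral_contains_not_neutral)
      then have i: "i \<in> J" "a i = e" "0 < weight i x" using weight_nonneg[of i x] by (auto simp: less_le split: if_splits)
      then have "0 < l i" using weight_pos_slack[OF x] by fastforce
      then show "e \<in> ?T" using i by auto
    qed
    moreover have "{e. gather k x e \<noteq> 0} \<subseteq> {e. push x e \<noteq> 0} \<union> {a k}" by (auto simp: g split: if_splits)
    ultimately have "?U \<subseteq> ?T" using k by auto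
    moreover have "?T \<in> faces - critical"
    proof -
      have "{} \<in> faces" by (simp add: faces_def)
      then have "{} \<union> ?T \<in> faces" by (intro add_special) auto
      then show ?thesis using k by (auto simp: critical_def)
    qed
    ultimately show ?thesis using noncritical.face_down by blast
  qed
  then show "?U \<in> faces" "x \<in> realization_points (faces - critical) \<Longrightarrow> ?U \<in> faces - critical" by auto
qed

lemma gather_in:
  assumes x: "x \<in> realization_points faces"
  shows "gather k x \<in> realization_points faces"
proof -
  define c where "c = max 0 (min 1 (2 * total x / eps - 1))"
  have c: "0 \<le> c" "c \<le> 1" by (auto simp: c_def)
  have g: "gather k x = (\<lambda>e. (1 - c) * push x e + c * (if e = a k then 1 else 0))"
    by (simp add: gather_def c_def)
  have "{e. gather k x e \<noteq> 0} \<in> faces" using gather_supp(1)[OF x] faces.face_down by blast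
  moreover have "0 \<le> gather k x e" for e
    using push_in[OF x] c by (simp add: g faces.realization_points_iff)
  moreover have "sum (gather k x) E = 1"
  proof -
    have "sum (gather k x) E = (1 - c) * sum (push x) E + c * (\<Sum>e\<in>E. if e = a k then 1 else 0)"
      by (simp add: g sum.distrib flip: sum_distrib_left)
    then show ?thesis
      using push_in[OF x] vertex_in by (simp add: faces.realization_points_iff noncritical.realization_points_iff)
  qed
  ultimately show ?thesis by (simp add: faces.realization_points_iff)
qed

lemma gather_noncritical:
  assumes "x \<in> realization_points (faces - critical)"
  shows "gather k x = (\<lambda>e. if e = a k then 1 else 0)"
proof -
  have "2 * total x / eps - 1 \<ge> 1" using total_ge_eps[OF assms] eps_pos by (simp add: field_simps)
  then have "max 0 (min 1 (2 * total x / eps - 1)) = 1" by simp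
  then show ?thesis by (simp add: gather_def)
qed

lemma continuous_truncate: "continuous_on (realization_points faces) truncate"
  unfolding truncate_def using truncate_sum_pos
  by (intro continuous_on_coordinatewise_then_product continuous_on_divide continuous_on_max continuous_on_sum
      continuous_on_diff continuous_on_const continuous_on_subset[OF continuous_on_product_coordinates]) fastforce+

lemma continuous_weight: "continuous_on (realization_points faces) (weight i)"
  unfolding weight_def esym_def
  by (intro continuous_on_max continuous_on_sum continuous_on_prod
      continuous_on_diff continuous_on_const continuous_on_subset[OF continuous_on_product_coordinates]) auto

lemma continuous_total: "continuous_on (realization_points faces) total"
  unfolding total_def by (intro continuous_on_sum continuous_weight)

lemma continuous_push: "continuous_on (realization_points faces) push"
proof -
  have "continuous_on (realization_points faces) (\<lambda>x. if a i = e then weight i x else 0)" for i e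
    using continuous_weight by (cases "a i = e") auto
  moreover have "max (total x) (eps / 2) \<noteq> 0" for x using denominator_pos[of x] by linarith
  ultimately show ?thesis
    unfolding push_def
    by (intro continuous_on_coordinatewise_then_product continuous_on_divide continuous_on_max continuous_on_sum
      continuous_on_add continuous_on_mult continuous_on_diff continuous_on_const continuous_total ballI
      continuous_on_product_then_coordinatewise[OF continuous_truncate])
qed

lemma continuous_gather: "continuous_on (realization_points faces) (gather k)"
  unfolding gather_def using eps_pos
  by (intro continuous_on_coordinatewise_then_product continuous_on_divide continuous_on_max continuous_on_min
      continuous_on_add continuous_on_mult continuous_on_diff continuous_on_const continuous_total ballI
      continuous_on_product_then_coordinatewise[OF continuous_push]) auto

text \<open>A direct segment from \<open>x\<close> to \<open>push x\<close> could leave the complex,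
  since positive weights control only the truncated support. Passing through \<open>truncate\<close>
  and \<open>push\<close> makes each segment lie in a face.\<close>

lemma homotopic_gather:
  "homotopic_with (\<lambda>h. h ` realization_points (faces - critical) \<subseteq> realization_points (faces - critical))
     (geometric_realization faces) (geometric_realization faces) id (gather k)"
proof -
  have LK: "x \<in> realization_points faces" if "x \<in> realization_points (faces - critical)" for x
    using that by (auto simp: realization_points_def)
  have union: "{e. x e \<noteq> 0} \<union> {e. truncate x e \<noteq> 0} = {e. x e \<noteq> 0}" if "x \<in> realization_points faces" for x
    using truncate_supp_subset[OF that] by auto
  note line = faces.homotopic_with_straight_line[OF noncritical.finite_complex_axioms Diff_subset]
  let ?P = "\<lambda>h. h ` realization_points (faces - critical) \<subseteq> realization_points (faces - critical)"
  let ?X = "geometric_realization faces"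
  have 1: "homotopic_with ?P ?X ?X id truncate"
    using union LK truncate_in continuous_truncate
    by (intro line) (auto simp: faces.realization_points_iff noncritical.realization_points_iff)
  have 2: "homotopic_with ?P ?X ?X truncate push"
  proof (intro line continuous_truncate continuous_push truncate_in push_in)
    fix x
    have sub: "{e. truncate x e \<noteq> 0} \<union> {e. push x e \<noteq> 0} \<subseteq> {e. truncate x e \<noteq> 0} \<union> a ` {i \<in> J. 0 < weight i x}"
      using push_supp by auto
    show "{e. truncate x e \<noteq> 0} \<union> {e. push x e \<noteq> 0} \<in> faces" if "x \<in> realization_points faces"
      using special_support_in_faces[OF that] sub by (rule faces.face_down)
    show "{e. truncate x e \<noteq> 0} \<union> {e. push x e \<noteq> 0} \<in> faces - critical" if "x \<in> realization_points (faces - critical)"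
      using special_support_noncritical[OF that] sub by (rule noncritical.face_down)
  qed
  have 3: "homotopic_with ?P ?X ?X push (gather k)"
    using LK by (intro line continuous_push continuous_gather push_in gather_in gather_supp) auto
  show ?thesis
    by (rule homotopic_with_trans[OF homotopic_with_trans[OF 1 2] 3])
qed

end

theorem homotopy_equivalent_wedge_of_critical:
  assumes b: "bij_betw b I critical" and d: "\<And>i. i \<in> I \<Longrightarrow> d i = int (card (b i)) - 1"
  shows "geometric_realization faces homotopy_equivalent_space wedge_of_spheres I d"
proof (cases "\<exists>k\<in>J. 0 < l k")
  case True
  then obtain k where k: "k \<in> J" "0 < l k" by auto
  show ?thesis
  proof (rule faces.homotopy_equivalent_wedge_of_facets[OF critical_subset critical_facet _ b d homotopic_gather[OF k]])
    show "{} \<notin> critical" using k by (auto simp: critical_def)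
    show "realization_points (faces - critical) \<noteq> {}" using vertex_in[OF k] by auto
  qed (auto simp: gather_noncritical[OF k])
next
  \<comment> \<open>The empty set is now the only face and itself critical, so there is nothing to
    collapse. The wedge is one of empty spheres, as \<open>d i = -1\<close>, over a nonempty index
    set, so both spaces are empty.\<close>
  case False
  then have l0: "l i = 0" if "i \<in> J" for i using that by auto
  have empty: "H = {}" if "H \<subseteq> E" "\<forall>i\<in>J. card (H \<inter> B i) \<le> l i" for H
    using that l0 E_eq finite_sub[OF that(1)] by auto
  have "faces = {{}}" using empty by (auto simp: faces_def)
  then have "topspace (geometric_realization faces) = {}"
    by (auto simp: geometric_realization_eq realization_points_def)
  moreover have "critical = {{}}" using empty l0 by (auto simp: critical_def)
  then have "b ` I = {{}}" using b by (simp add: bij_betw_def)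
  then have "I \<noteq> {}" and "\<And>i. i \<in> I \<Longrightarrow> b i = {}" by blast+
  then have "I \<noteq> {}" "\<And>i. i \<in> I \<Longrightarrow> sphere_space (d i) = trivial_topology"
    using d by (auto simp: sphere_space_def)
  then have "topspace (wedge_of_spheres I d) = {}"
    by (auto simp: wedge_of_spheres_def wedge_sum_def topspace_quotient_topology)
  ultimately have "geometric_realization faces homeomorphic_space wedge_of_spheres I d"
    by (simp add: homeomorphic_empty_space_eq)
  then show ?thesis by (rule homeomorphic_imp_homotopy_equivalent_space)
qed

end

section \<open>Caterpillars\<close>

abbreviation leaf_edge :: "nat \<Rightarrow> nat \<Rightarrow> cvertex set" where
  "leaf_edge i j \<equiv> {Central i, Leaf i j}"

lemma path_edges_eq: "path_edges n = (\<lambda>i. {Central i, Central (i + 1)}) ` {1..<n}"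
  by (auto simp: path_edges_def)

lemma caterpillar_edges_eq:
  "caterpillar_edges n m = path_edges n \<union> (\<Union>i\<in>{1..n}. leaf_edge i ` {1..m i})"
  unfolding caterpillar_edges_def by blast

lemma finite_path_edges: "finite (path_edges n)"
  by (simp add: path_edges_eq)

lemma finite_caterpillar_edges: "finite (caterpillar_edges n m)"
  by (simp add: caterpillar_edges_eq finite_path_edges)

lemma leaf_edge_notin_path: "leaf_edge i j \<notin> path_edges n"
  by (auto simp: path_edges_def doubleton_eq_iff)

lemma leaf_edge_eq_iff: "leaf_edge i j = leaf_edge i' j' \<longleftrightarrow> i = i' \<and> j = j'"
  by (auto simp: doubleton_eq_iff)

lemma leaf_edge_in_iff: "leaf_edge i j \<in> caterpillar_edges n m \<longleftrightarrow> i \<in> {1..n} \<and> j \<in> {1..m i}"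
  by (simp add: caterpillar_edges_def leaf_edge_notin_path leaf_edge_eq_iff)

definition incident :: "nat \<Rightarrow> (nat \<Rightarrow> nat) \<Rightarrow> nat \<Rightarrow> cvertex set set" where
  "incident n m i = {e \<in> caterpillar_edges n m. Central i \<in> e}"

lemma degree_complex_caterpillar:
  assumes "\<And>i. i \<in> {1..n} \<Longrightarrow> 1 \<le> m i"
  shows "degree_complex (caterpillar_edges n m) {1..n} (incident n m) (\<lambda>i. leaf_edge i 1)"
proof
  show "caterpillar_edges n m = (\<Union>i\<in>{1..n}. incident n m i)"
    by (fastforce simp: incident_def caterpillar_edges_eq path_edges_eq)
  show "leaf_edge i 1 \<in> incident n m i" if "i \<in> {1..n}" for i
    using assms[OF that] that by (auto simp: incident_def leaf_edge_in_iff)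
  show "leaf_edge i 1 \<notin> incident n m j" if "i \<noteq> j" for i j
    using that by (auto simp: incident_def)
qed (auto simp: finite_caterpillar_edges)

lemma vdegree_Central:
  "H \<subseteq> caterpillar_edges n m \<Longrightarrow> vdegree H (Central i) = card (H \<inter> incident n m i)"
  by (auto simp: vdegree_def incident_def intro!: arg_cong[of _ _ card])

text \<open>The only caterpillar edge that can contain \<open>Leaf i j\<close> is
  \<open>leaf_edge i j\<close>. This reduces the faces to the constraints at the central
  vertices.\<close>

lemma vdegree_Leaf:
  assumes "H \<subseteq> caterpillar_edges n m"
  shows "vdegree H (Leaf i j) \<le> 1"
proof -
  have "{e \<in> H. Leaf i j \<in> e} \<subseteq> {leaf_edge i j}"
    using assms by (auto simp: caterpillar_edges_eq path_edges_eq)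
  then show ?thesis
    unfolding vdegree_def using card_mono[of "{leaf_edge i j}"] by fastforce
qed

lemma BD_caterpillar_eq:
  "BD_caterpillar n m l =
     {H. H \<subseteq> caterpillar_edges n m \<and> (\<forall>i\<in>{1..n}. card (H \<inter> incident n m i) \<le> l i)}"
proof -
  have "(\<forall>v\<in>caterpillar_vertices n m. vdegree H v \<le> caterpillar_bound l v) \<longleftrightarrow>
      (\<forall>i\<in>{1..n}. card (H \<inter> incident n m i) \<le> l i)" if H: "H \<subseteq> caterpillar_edges n m" for H
    using vdegree_Leaf[OF H]
    unfolding caterpillar_vertices_def vdegree_Central[OF H, symmetric] ball_Un by auto
  then show ?thesis
    unfolding BD_caterpillar_def bounded_degree_complex_def by (intro Collect_cong conj_cong) auto
qed

section \<open>Counting critical facets\<close>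

lemma card_subsets_int_binom:
  assumes "finite A" "int (card A) = a"
  shows "card {S. S \<subseteq> A \<and> card S + t = k} = int_binom a (int k - int t)"
\<comment> \<open>Writing \<open>card S + t = k\<close> avoids truncated subtraction: for
  \<open>t > k\<close> no \<open>S\<close> qualifies, in accordance with the value 0 at a negative
  lower index.\<close>
proof (cases "t \<le> k")
  case True
  then have "{S. S \<subseteq> A \<and> card S + t = k} = {S. S \<subseteq> A \<and> card S = k - t}" by auto
  then have "card {S. S \<subseteq> A \<and> card S + t = k} = card A choose (k - t)"
    using n_subsets[OF assms(1)] by simp
  also have "\<dots> = int_binom a (int k - int t)"
    using True assms(2) by (auto simp: int_binom_def binomial_eq_0 nat_diff_distrib)
  finally show ?thesis .
next
  case False
  then have "{S. S \<subseteq> A \<and> card S + t = k} = {}" by auto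
  then show ?thesis using False by (simp add: int_binom_def)
qed

definition critical_facets :: "nat \<Rightarrow> (nat \<Rightarrow> nat) \<Rightarrow> (nat \<Rightarrow> nat) \<Rightarrow> cvertex set set set" where
  "critical_facets n m l = {F. F \<subseteq> caterpillar_edges n m \<and>
     (\<forall>i\<in>{1..n}. leaf_edge i 1 \<notin> F \<and> card (F \<inter> incident n m i) = l i)}"

lemma path_edge_card:
  assumes "e \<in> path_edges n"
  shows "card {i \<in> {1..n}. Central i \<in> e} = 2"
proof -
  obtain i where "e = {Central i, Central (i + 1)}" "1 \<le> i" "i < n"
    using assms by (auto simp: path_edges_def)
  then have "{i \<in> {1..n}. Central i \<in> e} = {i, i + 1}" by auto
  then show ?thesis by simp
qed

text \<open>Counting incidences: a path edge meets two central vertices, a leaf edge only one.\<close>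

lemma card_critical_facet:
  assumes F: "F \<in> critical_facets n m l"
  shows "card F + card (F \<inter> path_edges n) = (\<Sum>i=1..n. l i)"
proof -
  have FE: "F \<subseteq> caterpillar_edges n m" using F by (simp add: critical_facets_def)
  have fin: "finite F" using FE finite_caterpillar_edges finite_subset by blast
  have "card {i \<in> {1..n}. Central i \<in> e} = (if e \<in> path_edges n then 2 else 1)" if "e \<in> F" for e
  proof (cases "e \<in> path_edges n")
    case False
    moreover have "e \<in> caterpillar_edges n m" using that FE by blast
    ultimately obtain i j where "i \<in> {1..n}" "e = leaf_edge i j"
      unfolding caterpillar_edges_def by blast
    then have "{i \<in> {1..n}. Central i \<in> e} = {i}" by auto
    then show ?thesis using False by simp
  qed (use path_edge_card in simp)
  then have "(\<Sum>i\<in>{1..n}. card {e \<in> F. Central i \<in> e}) = (\<Sum>e\<in>F. if e \<in> path_edges n then 2 else 1)"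
    using fin by (intro sum_multicount_gen) auto
  also have "\<dots> = (\<Sum>e\<in>F. 1 + (if e \<in> path_edges n then 1 else 0))"
    by (intro sum.cong) auto
  also have "\<dots> = card F + card (F \<inter> path_edges n)"
    unfolding sum.distrib using fin by (simp add: sum.inter_restrict[symmetric])
  also have "(\<Sum>i\<in>{1..n}. card {e \<in> F. Central i \<in> e}) = (\<Sum>i=1..n. l i)"
  proof (rule sum.cong)
    fix i assume "i \<in> {1..n}"
    then show "card {e \<in> F. Central i \<in> e} = l i"
      using F vdegree_Central[OF FE, of i] by (simp add: critical_facets_def vdegree_def)
  qed simp
  finally show ?thesis by simp
qed

lemma card_critical_facets_over:
  assumes m: "\<And>i. i \<in> {1..n} \<Longrightarrow> 1 \<le> m i" and T: "T \<subseteq> path_edges n"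
  shows "card {F \<in> critical_facets n m l. F \<inter> path_edges n = T} = sphere_count n m l T"
proof -
  \<comment> \<open>Index 1 is left out because the first leaf edge is excluded from critical
    facets.\<close>
  define A where "A i = {S. S \<subseteq> {2..m i} \<and> card S + vdegree T (Central i) = l i}" for i
  define \<phi> where "\<phi> f = T \<union> (\<Union>i\<in>{1..n}. leaf_edge i ` f i)" for f :: "nat \<Rightarrow> nat set"
  \<comment> \<open>The restriction to \<open>{1..n}\<close> gives the value
    \<open>undefined\<close> elsewhere, as membership in \<open>Pi\<^sub>E\<close> demands.\<close>
  define \<psi> where "\<psi> F = (\<lambda>i\<in>{1..n}. {j. leaf_edge i j \<in> F})" for F
  have leaf_\<phi>: "leaf_edge i j \<in> \<phi> f \<longleftrightarrow> i \<in> {1..n} \<and> j \<in> f i" for i j f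
    using T leaf_edge_notin_path by (auto simp: \<phi>_def leaf_edge_eq_iff)
  have deg: "card (F \<inter> incident n m i) = vdegree T (Central i) + card {j. leaf_edge i j \<in> F}"
    if F: "F \<subseteq> caterpillar_edges n m" "F \<inter> path_edges n = T" for F i
  proof -
    have "F \<inter> incident n m i = {e \<in> T. Central i \<in> e} \<union> leaf_edge i ` {j. leaf_edge i j \<in> F}"
      using F by (auto simp: incident_def caterpillar_edges_eq)
    moreover have "{e \<in> T. Central i \<in> e} \<inter> leaf_edge i ` {j. leaf_edge i j \<in> F} = {}"
      using T leaf_edge_notin_path by auto
    moreover have "finite F" using F(1) finite_caterpillar_edges finite_subset by blast
    then have "finite {e \<in> T. Central i \<in> e}" "finite (leaf_edge i ` {j. leaf_edge i j \<in> F})"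
      using F(2) by (auto intro: finite_subset[of _ F])
    moreover have "card (leaf_edge i ` {j. leaf_edge i j \<in> F}) = card {j. leaf_edge i j \<in> F}"
      by (intro card_image inj_onI) (simp add: leaf_edge_eq_iff)
    ultimately show ?thesis by (simp add: card_Un_disjoint vdegree_def)
  qed
  have "bij_betw \<phi> (Pi\<^sub>E {1..n} A) {F \<in> critical_facets n m l. F \<inter> path_edges n = T}"
  proof (rule bij_betw_byWitness[where f' = \<psi>])
    show "\<forall>f\<in>Pi\<^sub>E {1..n} A. \<psi> (\<phi> f) = f"
    proof
      fix f assume "f \<in> Pi\<^sub>E {1..n} A"
      then show "\<psi> (\<phi> f) = f"
        unfolding \<psi>_def leaf_\<phi> by (auto simp: fun_eq_iff PiE_iff extensional_def restrict_def)
    qed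
    show "\<forall>F\<in>{F \<in> critical_facets n m l. F \<inter> path_edges n = T}. \<phi> (\<psi> F) = F"
      by (fastforce simp: \<phi>_def \<psi>_def critical_facets_def caterpillar_edges_eq)
    show "\<phi> ` Pi\<^sub>E {1..n} A \<subseteq> {F \<in> critical_facets n m l. F \<inter> path_edges n = T}"
    proof
      fix F assume "F \<in> \<phi> ` Pi\<^sub>E {1..n} A"
      then obtain f where f: "f \<in> Pi\<^sub>E {1..n} A" "F = \<phi> f" by auto
      have fA: "f i \<subseteq> {2..m i}" "card (f i) + vdegree T (Central i) = l i" if "i \<in> {1..n}" for i
        using f(1) that by (auto simp: A_def PiE_iff)
      have sub: "F \<subseteq> caterpillar_edges n m"
        using fA(1) T unfolding f(2) \<phi>_def caterpillar_edges_eq by fastforce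
      have int: "F \<inter> path_edges n = T"
        using T leaf_edge_notin_path by (auto simp: f(2) \<phi>_def)
      have "leaf_edge i 1 \<notin> F \<and> card (F \<inter> incident n m i) = l i" if "i \<in> {1..n}" for i
        using deg[OF sub int, of i] fA[OF that] that unfolding f(2) leaf_\<phi> by auto
      then show "F \<in> {F \<in> critical_facets n m l. F \<inter> path_edges n = T}"
        using sub int by (auto simp: critical_facets_def)
    qed
    show "\<psi> ` {F \<in> critical_facets n m l. F \<inter> path_edges n = T} \<subseteq> Pi\<^sub>E {1..n} A"
    proof (rule image_subsetI)
      fix F assume F: "F \<in> {F \<in> critical_facets n m l. F \<inter> path_edges n = T}"
      then have FE: "F \<subseteq> caterpillar_edges n m" and int: "F \<inter> path_edges n = T" by (auto simp: critical_facets_def)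
      have "{j. leaf_edge i j \<in> F} \<in> A i" if i: "i \<in> {1..n}" for i
      proof -
        have "j \<in> {2..m i}" if "leaf_edge i j \<in> F" for j
        proof -
          have "j \<in> {1..m i}" using that FE leaf_edge_in_iff by blast
          moreover have "j \<noteq> 1" using that F i by (auto simp: critical_facets_def)
          ultimately show ?thesis by auto
        qed
        moreover have "card (F \<inter> incident n m i) = l i" using F i by (auto simp: critical_facets_def)
        ultimately show ?thesis using deg[OF FE int, of i] by (auto simp: A_def)
      qed
      then show "\<psi> F \<in> Pi\<^sub>E {1..n} A" by (auto simp: \<psi>_def)
    qed
  qed
  then have "card {F \<in> critical_facets n m l. F \<inter> path_edges n = T} = card (Pi\<^sub>E {1..n} A)"
    by (simp add: bij_betw_same_card)
  also have "\<dots> = (\<Prod>i=1..n. card (A i))" by (simp add: card_PiE)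
  \<comment> \<open>The hypothesis \<open>1 \<le> m i\<close> identifies the cardinality of
    \<open>{2..m i}\<close> with the integer \<open>m i - 1\<close>.\<close>
  also have "\<dots> = sphere_count n m l T"
    unfolding sphere_count_def A_def
    by (intro prod.cong card_subsets_int_binom) (use m in \<open>auto simp: of_nat_diff\<close>)
  finally show ?thesis .
qed

lemma finite_critical_facets: "finite (critical_facets n m l)"
  by (rule finite_subset[of _ "Pow (caterpillar_edges n m)"])
     (auto simp: critical_facets_def finite_caterpillar_edges)

theorem theorem4p3:
  fixes n :: nat and m l :: "nat \<Rightarrow> nat"
  assumes "\<And>i. i \<in> {1..n} \<Longrightarrow> 1 \<le> m i"
  shows "geometric_realization (BD_caterpillar n m l) homotopy_equivalent_space
    wedge_of_spheres (SIGMA T : Pow (path_edges n). {..<sphere_count n m l T})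
      (\<lambda>(T, k). int (\<Sum>i = 1..n. l i) - int (card T) - 1)"
proof -
  interpret degree_complex "caterpillar_edges n m" "{1..n}" "incident n m" "\<lambda>i. leaf_edge i 1" l
    using assms by (rule degree_complex_caterpillar)
  have faces: "faces = BD_caterpillar n m l"
    unfolding faces_def BD_caterpillar_eq ..
  have crit: "critical = critical_facets n m l"
    unfolding critical_def critical_facets_def ..
  let ?C = "\<lambda>T. {F \<in> critical_facets n m l. F \<inter> path_edges n = T}"
  let ?I = "SIGMA T : Pow (path_edges n). {..<sphere_count n m l T}"
  have "\<exists>h. bij_betw h {..<sphere_count n m l T} (?C T)" if "T \<subseteq> path_edges n" for T
  proof -
    have "card (?C T) = sphere_count n m l T" using assms that by (rule card_critical_facets_over)
    then show ?thesis
      using ex_bij_betw_nat_finite[of "?C T"] finite_critical_facets[of n m l] by (simp add: atLeast0LessThan)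
  qed
  then obtain h where h: "\<And>T. T \<subseteq> path_edges n \<Longrightarrow> bij_betw (h T) {..<sphere_count n m l T} (?C T)"
    by metis
  have h_in: "h T k \<in> critical_facets n m l" "h T k \<inter> path_edges n = T" if "(T, k) \<in> ?I" for T k
    using bij_betwE[OF h[of T]] that by auto
  \<comment> \<open>The enumerations \<open>h T\<close> glue to a bijection because \<open>T\<close>
    can be read off a facet as its set of path edges.\<close>
  have b: "bij_betw (\<lambda>(T, k). h T k) ?I critical"
    unfolding bij_betw_def
  proof
    show "inj_on (\<lambda>(T, k). h T k) ?I"
    proof (rule inj_onI)
      fix z z' assume "z \<in> ?I" "z' \<in> ?I" and eq: "(case z of (T, k) \<Rightarrow> h T k) = (case z' of (T, k) \<Rightarrow> h T k)"
      then obtain T k T' k' where z: "z = (T, k)" "z' = (T', k')" "(T, k) \<in> ?I" "(T', k') \<in> ?I"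
        by (cases z; cases z') auto
      then have "T = T'" using h_in(2)[OF z(3)] h_in(2)[OF z(4)] eq by simp
      then show "z = z'" using z eq h[of T] by (auto simp: bij_betw_def inj_on_def)
    qed
    show "(\<lambda>(T, k). h T k) ` ?I = critical"
    proof
      show "(\<lambda>(T, k). h T k) ` ?I \<subseteq> critical" using h_in unfolding crit by auto
      show "critical \<subseteq> (\<lambda>(T, k). h T k) ` ?I"
      proof
        fix F assume F: "F \<in> critical"
        let ?T = "F \<inter> path_edges n"
        have "F \<in> h ?T ` {..<sphere_count n m l ?T}"
          using h[of ?T] F unfolding crit by (auto simp: bij_betw_def)
        then obtain k where "k < sphere_count n m l ?T" "F = h ?T k" by auto
        then show "F \<in> (\<lambda>(T, k). h T k) ` ?I" by (intro image_eqI[of _ _ "(?T, k)"]) auto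
      qed
    qed
  qed
  have "geometric_realization faces homotopy_equivalent_space
      wedge_of_spheres ?I (\<lambda>(T, k). int (\<Sum>i = 1..n. l i) - int (card T) - 1)"
  proof (rule homotopy_equivalent_wedge_of_critical[OF b])
    fix z assume "z \<in> ?I"
    then obtain T k where z: "z = (T, k)" "(T, k) \<in> ?I" by (cases z) auto
    \<comment> \<open>A facet with path edges \<open>T\<close> has as many edges as the sum of the
      bounds minus \<open>card T\<close>; its dimension is one less.\<close>
    have "card (h T k) + card T = (\<Sum>i = 1..n. l i)"
      using card_critical_facet[OF h_in(1)[OF z(2)]] h_in(2)[OF z(2)] by simp
    then have "int (\<Sum>i = 1..n. l i) = int (card (h T k)) + int (card T)"
      by (metis of_nat_add)
    then show "(case z of (T, k) \<Rightarrow> int (\<Sum>i = 1..n. l i) - int (card T) - 1)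
        = int (card (case z of (T, k) \<Rightarrow> h T k)) - 1"
      by (simp add: z)
  qed
  then show ?thesis unfolding faces .
qed

end
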